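(* Assume $\|X\|/p\le\lambda\le 2\bar\lambda$ with $\bar\lambda=2\|X\|\sqrt{\log p}$, and that there are constants $A_1,A_2,A_3>0$ and $A_4>1$ (not depending on $p$) such that $A_1p^{-A_3}\pi_p(s-1)\le\pi_p(s)\le A_2p^{-A_4}\pi_p(s-1)$ for $s=1,\dots,p$. Then for every $c_0>0$ and any sequence $s_n\le p^a$ with $s_n\lambda\sqrt{\log p}/\|X\|\to0$ and $a<A_4-1$, \[ \sup\ \mathbb E_{\beta^0}\Pi\big(\beta:S_\beta\supset S_{\beta^0},\ S_\beta\ne S_{\beta^0}\ \big|\ Y\big)\to0 \] as $n,p\to\infty$, where the supremum is over all $\beta^0\in\mathbb R^p$ with $\phi(S_0)\ge c_0$, $|S_0|\le s_n$ and $\tilde\psi(S_0)\ge c_0$, $S_0=S_{\beta^0}$.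
   Context: Observations follow $Y=X\beta+\varepsilon$ with $X$ a deterministic real $n\times p$ matrix and $\varepsilon\sim N_n(0,I_n)$. $\mathbb E_{\beta^0}$ denotes expectation when $Y\sim N_n(X\beta^0,I_n)$. $S_\beta=\{i:\beta_i\ne0\}$, $\beta_S=(\beta_i)_{i\in S}$, $\|X\|=\max_i\|X_{\cdot,i}\|_2$. Prior $\Pi$: draw $s\sim\pi_p$ on $\{0,\dots,p\}$, then $S$ uniform among subsets of size $s$, then $\beta_i$, $i\in S$, i.i.d. with density $\frac{\lambda}{2}e^{-\lambda|x|}$, $\beta_i=0$ for $i\notin S$. Posterior $\Pi(B\mid Y)=\int_Be^{-\|Y-X\beta\|_2^2/2}d\Pi(\beta)/\int e^{-\|Y-X\beta\|_2^2/2}d\Pi(\beta)$. $\phi(S)=\inf\{\|X\beta\|_2|S|^{1/2}/(\|X\|\|\beta_S\|_1):\|\beta_{S^c}\|_1\le7\|\beta_S\|_1,\beta_S\ne0\}$; $\tilde\phi(s)=\inf\{\|X\beta\|_2/(\|X\|\|\beta\|_2):0\ne|S_\beta|\le s\}$; $\tilde\psi(S)=\tilde\phi\big((2+\frac{3}{A_4}+\frac{33}{\phi(S)^2}\frac{\lambda}{\bar\lambda})|S|\big)$. Asymptotics: $n,p\to\infty$ with $X,\lambda,\pi_p$ depending on $n,p$ subject to the assumptions (constants $A_i$, $a$ fixed). *)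

theory Defs
  imports "HOL-Probability.Probability"
begin

text \<open>Vectors in R^m are functions nat => real, only coordinates i < m matter.
  An n x p design matrix is X :: nat => nat => real, entry X i j (i < n, j < p).\<close>

definition l2norm :: "nat \<Rightarrow> (nat \<Rightarrow> real) \<Rightarrow> real" where
  "l2norm m v = sqrt (\<Sum>i<m. (v i)^2)"

definition l1norm :: "nat set \<Rightarrow> (nat \<Rightarrow> real) \<Rightarrow> real" where
  "l1norm S v = (\<Sum>i\<in>S. \<bar>v i\<bar>)"

definition matvec :: "nat \<Rightarrow> (nat \<Rightarrow> nat \<Rightarrow> real) \<Rightarrow> (nat \<Rightarrow> real) \<Rightarrow> nat \<Rightarrow> real" where
  "matvec p X \<beta> = (\<lambda>i. \<Sum>j<p. X i j * \<beta> j)"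

definition colnorm :: "nat \<Rightarrow> (nat \<Rightarrow> nat \<Rightarrow> real) \<Rightarrow> nat \<Rightarrow> real" where
  "colnorm n X j = sqrt (\<Sum>i<n. (X i j)^2)"

definition Xnorm :: "nat \<Rightarrow> nat \<Rightarrow> (nat \<Rightarrow> nat \<Rightarrow> real) \<Rightarrow> real" where
  "Xnorm n p X = Max (colnorm n X ` {..<p})"

definition lambar :: "nat \<Rightarrow> nat \<Rightarrow> (nat \<Rightarrow> nat \<Rightarrow> real) \<Rightarrow> real" where
  "lambar n p X = 2 * Xnorm n p X * sqrt (ln (real p))"

definition supp :: "nat \<Rightarrow> (nat \<Rightarrow> real) \<Rightarrow> nat set" where
  "supp p \<beta> = {i \<in> {..<p}. \<beta> i \<noteq> 0}"

text \<open>Compatibility number phi(S) (infimum over the empty set is +infinity).\<close>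
definition compat :: "nat \<Rightarrow> nat \<Rightarrow> (nat \<Rightarrow> nat \<Rightarrow> real) \<Rightarrow> nat set \<Rightarrow> ereal" where
  "compat n p X S =
     (INF \<beta> \<in> {\<beta>. l1norm ({..<p} - S) \<beta> \<le> 7 * l1norm S \<beta> \<and> (\<exists>j\<in>S. \<beta> j \<noteq> 0)}.
        ereal (l2norm n (matvec p X \<beta>) * sqrt (real (card S)) / (Xnorm n p X * l1norm S \<beta>)))"

definition tphi :: "nat \<Rightarrow> nat \<Rightarrow> (nat \<Rightarrow> nat \<Rightarrow> real) \<Rightarrow> real \<Rightarrow> ereal" where
  "tphi n p X s =
     (INF \<beta> \<in> {\<beta>. supp p \<beta> \<noteq> {} \<and> real (card (supp p \<beta>)) \<le> s}.
        ereal (l2norm n (matvec p X \<beta>) / (Xnorm n p X * l2norm p \<beta>)))"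

definition tpsi :: "nat \<Rightarrow> nat \<Rightarrow> (nat \<Rightarrow> nat \<Rightarrow> real) \<Rightarrow> real \<Rightarrow> real \<Rightarrow> nat set \<Rightarrow> ereal" where
  "tpsi n p X lam A4 S =
     tphi n p X ((2 + 3 / A4 + 33 / (real_of_ereal (compat n p X S))^2 * (lam / lambar n p X))
                 * real (card S))"

definition laplace_density :: "real \<Rightarrow> real \<Rightarrow> real" where
  "laplace_density lam x = lam / 2 * exp (- lam * \<bar>x\<bar>)"

definition prior_comp :: "nat \<Rightarrow> real \<Rightarrow> nat set \<Rightarrow> (nat \<Rightarrow> real) measure" where
  "prior_comp p lam S =
     PiM {..<p} (\<lambda>j. if j \<in> S then density lborel (laplace_density lam) else return lborel 0)"

definition prior_int :: "nat \<Rightarrow> real \<Rightarrow> (nat \<Rightarrow> real) \<Rightarrow> ((nat \<Rightarrow> real) \<Rightarrow> real) \<Rightarrow> real" where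
  "prior_int p lam prs f =
     (\<Sum>S\<in>Pow {..<p}. prs (card S) / real (p choose card S) * (\<integral>\<beta>. f \<beta> \<partial>prior_comp p lam S))"

definition likelihood :: "nat \<Rightarrow> nat \<Rightarrow> (nat \<Rightarrow> nat \<Rightarrow> real) \<Rightarrow> (nat \<Rightarrow> real) \<Rightarrow> (nat \<Rightarrow> real) \<Rightarrow> real" where
  "likelihood n p X Y \<beta> = exp (- ((l2norm n (\<lambda>i. Y i - matvec p X \<beta> i))^2 / 2))"

definition posterior ::
  "nat \<Rightarrow> nat \<Rightarrow> (nat \<Rightarrow> nat \<Rightarrow> real) \<Rightarrow> real \<Rightarrow> (nat \<Rightarrow> real) \<Rightarrow> (nat \<Rightarrow> real) set \<Rightarrow> (nat \<Rightarrow> real) \<Rightarrow> real" where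
  "posterior n p X lam prs B Y =
     prior_int p lam prs (\<lambda>\<beta>. indicator B \<beta> * likelihood n p X Y \<beta>)
       / prior_int p lam prs (likelihood n p X Y)"

definition noise :: "nat \<Rightarrow> (nat \<Rightarrow> real) measure" where
  "noise n = PiM {..<n} (\<lambda>_. density lborel std_normal_density)"

definition post_exp ::
  "nat \<Rightarrow> nat \<Rightarrow> (nat \<Rightarrow> nat \<Rightarrow> real) \<Rightarrow> real \<Rightarrow> (nat \<Rightarrow> real) \<Rightarrow> (nat \<Rightarrow> real) \<Rightarrow> (nat \<Rightarrow> real) set \<Rightarrow> real" where
  "post_exp n p X lam prs \<beta>0 B =
     (\<integral>\<epsilon>. posterior n p X lam prs B (\<lambda>i. matvec p X \<beta>0 i + \<epsilon> i) \<partial>noise n)"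

end

theory Submission
  imports Defs
begin

text \<open>Fix a model \<open>S\<close> strictly containing the true model \<open>S\<^sub>0\<close> and write the columns outside
  \<open>S\<^sub>0\<close> as a combination of the columns in \<open>S\<^sub>0\<close> plus an orthogonal part. Shifting the
  \<open>S\<^sub>0\<close>-coordinates by this combination factorizes the likelihood and costs only an exponential of
  the \<open>l\<^sub>1\<close>-norm of the shift under the Laplace prior, so the ratio of the marginal likelihoods of
  \<open>S\<close> and \<open>S\<^sub>0\<close> is at most an integral over the coordinates outside \<open>S\<^sub>0\<close> alone. Except on an
  event of probability \<open>2 / p\<close>, the compatibility condition bounds the expectation of this integral
  by \<open>exp (o(1)) * 2 ^ k\<close> with \<open>k = card (S - S\<^sub>0)\<close>; the error is of order
  \<open>s * lam * sqrt (ln p) / Xnorm\<close>. Summing over \<open>S\<close> with the prior weights leaves the geometric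
  series \<open>(\<Sum>k\<ge>1. (2 * (s + 1) * A2 * p powr (- A4)) ^ k)\<close>, which vanishes.\<close>

section \<open>Inner products and projection coefficients\<close>

definition dotp :: "nat \<Rightarrow> (nat \<Rightarrow> real) \<Rightarrow> (nat \<Rightarrow> real) \<Rightarrow> real" where
  "dotp n u v = (\<Sum>i<n. u i * v i)"

lemma l2norm_nonneg: "0 \<le> l2norm n u"
  by (simp add: l2norm_def sum_nonneg)

lemma l2norm_square: "(l2norm n u)\<^sup>2 = dotp n u u"
  by (simp add: l2norm_def dotp_def sum_nonneg power2_eq_square)

lemma dotp_commute: "dotp n u v = dotp n v u"
  by (simp add: dotp_def mult.commute)

lemma dotp_add_left: "dotp n (\<lambda>i. u i + v i) w = dotp n u w + dotp n v w"
  by (simp add: dotp_def algebra_simps sum.distrib)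

lemma dotp_diff_right: "dotp n w (\<lambda>i. u i - v i) = dotp n w u - dotp n w v"
  by (simp add: dotp_def algebra_simps sum_subtractf)

lemma dotp_scale_right: "dotp n w (\<lambda>i. c * u i) = c * dotp n w u"
  by (simp add: dotp_def sum_distrib_left algebra_simps)

lemma dotp_sum_left: "dotp n (\<lambda>i. \<Sum>j\<in>T. f j i) w = (\<Sum>j\<in>T. dotp n (f j) w)"
  unfolding dotp_def by (subst sum.swap) (simp add: sum_distrib_right)

lemma dotp_matvec: "dotp n u (matvec p X v) = (\<Sum>j<p. v j * dotp n u (\<lambda>m. X m j))"
  unfolding dotp_def matvec_def sum_distrib_left
  by (subst sum.swap) (simp add: algebra_simps)

text \<open>Gram-Schmidt by induction on \<open>T\<close>, covering linearly dependent vectors too.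
  The residuals \<open>r\<close> of \<open>y\<close> and \<open>q\<close> of the new vector are
  orthogonal to the old vectors, hence so is \<open>r - \<alpha> * q\<close>. As
  \<open>x t - q\<close> lies in the span of the old vectors, orthogonality to \<open>x t\<close>
  reduces to orthogonality to \<open>q\<close>, which fixes \<open>\<alpha>\<close>.\<close>

lemma projection_coeffs:
  assumes "finite T"
  shows "\<exists>g. \<forall>i\<in>T. dotp n (x i) (\<lambda>m. y m - (\<Sum>j\<in>T. g j * x j m)) = 0"
  using assms
proof (induction T arbitrary: y rule: finite_induct)
  case empty
  then show ?case by simp
next
  case (insert t T)
  obtain g where g: "\<And>i. i \<in> T \<Longrightarrow> dotp n (x i) (\<lambda>m. y m - (\<Sum>j\<in>T. g j * x j m)) = 0"
    using insert.IH by blast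
  obtain h where h: "\<And>i. i \<in> T \<Longrightarrow> dotp n (x i) (\<lambda>m. x t m - (\<Sum>j\<in>T. h j * x j m)) = 0"
    using insert.IH by blast
  define r where "r = (\<lambda>m. y m - (\<Sum>j\<in>T. g j * x j m))"
  define q where "q = (\<lambda>m. x t m - (\<Sum>j\<in>T. h j * x j m))"
  \<comment> \<open>If \<open>dotp n q q = 0\<close>, the division yields 0; \<open>q\<close> then
    vanishes below \<open>n\<close>, and both sides of \<open>q0\<close> are 0.\<close>
  define \<alpha> where "\<alpha> = dotp n q r / dotp n q q"
  define k where "k = (\<lambda>j. if j = t then \<alpha> else g j - \<alpha> * h j)"
  have "(\<Sum>j\<in>insert t T. k j * x j m) = \<alpha> * x t m + (\<Sum>j\<in>T. (g j - \<alpha> * h j) * x j m)" for m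
    using insert.hyps by (auto simp: k_def intro!: sum.cong)
  then have sum_k: "(\<Sum>j\<in>insert t T. k j * x j m)
      = \<alpha> * x t m + (\<Sum>j\<in>T. g j * x j m) - \<alpha> * (\<Sum>j\<in>T. h j * x j m)" for m
    by (simp add: algebra_simps sum_subtractf sum_distrib_left)
  have res: "(\<lambda>m. y m - (\<Sum>j\<in>insert t T. k j * x j m)) = (\<lambda>m. r m - \<alpha> * q m)"
    by (simp only: sum_k r_def q_def) (simp add: algebra_simps)
  have T: "dotp n (x i) (\<lambda>m. r m - \<alpha> * q m) = 0" if "i \<in> T" for i
    using g[OF that] h[OF that] by (simp add: dotp_diff_right dotp_scale_right r_def q_def)
  have q0: "dotp n q r = \<alpha> * dotp n q q"
  proof (cases "dotp n q q = 0")
    case True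
    then have "\<forall>i<n. q i = 0"
      by (auto simp: dotp_def sum_nonneg_eq_0_iff)
    then show ?thesis by (simp add: dotp_def)
  qed (simp add: \<alpha>_def)
  have xt: "x t = (\<lambda>m. q m + (\<Sum>j\<in>T. h j * x j m))"
    by (simp add: q_def)
  have sc: "dotp n (\<lambda>m. c * u m) w = c * dotp n u w" for c u w
    by (simp add: dotp_def sum_distrib_left algebra_simps)
  have "dotp n (x t) (\<lambda>m. r m - \<alpha> * q m) = 0"
    by (subst xt) (simp add: dotp_add_left dotp_sum_left sc T, simp add: dotp_diff_right dotp_scale_right q0)
  with T show ?case
    by (intro exI[of _ k]) (auto simp: res)
qed

section \<open>Laplace and Gaussian integrals\<close>

abbreviation laplace :: "real \<Rightarrow> real measure" where
  "laplace lam \<equiv> density lborel (laplace_density lam)"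

lemma laplace_density_measurable [measurable]: "laplace_density lam \<in> borel_measurable borel"
  unfolding laplace_density_def by measurable

lemma nn_integral_exp_abs:
  assumes "c > 0"
  shows "(\<integral>\<^sup>+x. ennreal (exp (- c * \<bar>x\<bar>)) \<partial>lborel) = ennreal (2 / c)"
proof -
  have half: "(\<integral>\<^sup>+x. ennreal (exp (- c * x)) * indicator {0..} x \<partial>lborel) = ennreal (1 / c)"
  proof -
    have "(\<integral>\<^sup>+x. ennreal (exp (- c * x)) * indicator {0..} x \<partial>lborel)
        = ennreal (0 - (- exp (- c * 0) / c))"
    proof (rule nn_integral_FTC_atLeast)
      show "((\<lambda>x. - exp (- c * x) / c) \<longlongrightarrow> 0) at_top"
        using assms by real_asymp
    qed (use assms in \<open>auto intro!: derivative_eq_intros\<close>)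
    then show ?thesis by simp
  qed
  have "(\<integral>\<^sup>+x. ennreal (exp (- c * \<bar>x\<bar>)) \<partial>lborel)
      = (\<integral>\<^sup>+x. ennreal (exp (- c * x)) * indicator {0..} x
           + ennreal (exp (- c * (- x))) * indicator {0..} (- x) \<partial>lborel)"
    \<comment> \<open>Both half-line terms equal 1 at the origin, so the identity holds only off
      this null set.\<close>
    using AE_lborel_singleton[of "0::real"]
    by (intro nn_integral_cong_AE) (auto simp: indicator_def elim!: eventually_mono)
  also have "\<dots> = (\<integral>\<^sup>+x. ennreal (exp (- c * x)) * indicator {0..} x \<partial>lborel)
      + (\<integral>\<^sup>+x. ennreal (exp (- c * (- x))) * indicator {0..} (- x) \<partial>lborel)"
    by (rule nn_integral_add) auto
  also have "(\<integral>\<^sup>+x. ennreal (exp (- c * (- x))) * indicator {0..} (- x) \<partial>lborel)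
     = (\<integral>\<^sup>+x. ennreal (exp (- c * x)) * indicator {0..} x \<partial>lborel)"
    by (subst (2) nn_integral_real_affine[where c="-1" and t=0]) auto
  finally show ?thesis
    unfolding half using assms by (simp flip: ennreal_plus)
qed

text \<open>The instance \<open>c = lam / 2\<close> has value 2, the source of the factor
  \<open>2 ^ k\<close> in the final series; \<open>c = 0\<close> gives total mass 1.\<close>

lemma nn_integral_laplace_exp:
  assumes "0 < lam" "c < lam"
  shows "(\<integral>\<^sup>+x. ennreal (exp (c * \<bar>x\<bar>)) \<partial>laplace lam) = ennreal (lam / (lam - c))"
proof -
  have "(\<integral>\<^sup>+x. ennreal (exp (c * \<bar>x\<bar>)) \<partial>laplace lam)
      = (\<integral>\<^sup>+x. ennreal (lam / 2) * ennreal (exp (- (lam - c) * \<bar>x\<bar>)) \<partial>lborel)"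
    using assms
    by (auto simp: nn_integral_density laplace_density_def algebra_simps
          simp flip: ennreal_mult exp_add intro!: nn_integral_cong)
  also have "\<dots> = ennreal (lam / 2) * ennreal (2 / (lam - c))"
    using assms by (subst nn_integral_cmult) (auto simp: nn_integral_exp_abs[of "lam - c", simplified])
  finally show ?thesis
    using assms by (simp flip: ennreal_mult)
qed

lemma prob_space_laplace:
  assumes "0 < lam"
  shows "prob_space (laplace lam)"
proof
  show "emeasure (laplace lam) (space (laplace lam)) = 1"
    using nn_integral_laplace_exp[OF assms assms] assms by simp
qed

text \<open>Translation invariance of Lebesgue measure moves the shift into the density, and |x| <=
  |c| + |x - c| bounds the resulting ratio of densities.\<close>

lemma nn_integral_laplace_shift:
  assumes "0 < lam" and [measurable]: "f \<in> borel_measurable borel"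
  shows "(\<integral>\<^sup>+x. f x \<partial>laplace lam) \<le> ennreal (exp (lam * \<bar>c\<bar>)) * (\<integral>\<^sup>+x. f (x - c) \<partial>laplace lam)"
proof -
  have *: "laplace_density lam (x - c) \<le> exp (lam * \<bar>c\<bar>) * laplace_density lam x" for x
  proof -
    have "lam * \<bar>x\<bar> \<le> lam * (\<bar>c\<bar> + \<bar>x - c\<bar>)"
      using assms by (intro mult_left_mono) auto
    then have "exp (- lam * \<bar>x - c\<bar>) \<le> exp (lam * \<bar>c\<bar>) * exp (- lam * \<bar>x\<bar>)"
      by (simp add: algebra_simps flip: exp_add)
    then show ?thesis
      using assms by (simp add: laplace_density_def)
  qed
  have nonneg: "0 \<le> laplace_density lam x" for x
    using assms by (simp add: laplace_density_def)
  have "(\<integral>\<^sup>+x. f x \<partial>laplace lam) = (\<integral>\<^sup>+x. ennreal (laplace_density lam x) * f x \<partial>lborel)"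
    by (simp add: nn_integral_density)
  also have "\<dots> = (\<integral>\<^sup>+x. ennreal (laplace_density lam (x - c)) * f (x - c) \<partial>lborel)"
    by (subst nn_integral_real_affine[where c=1 and t="-c"]) auto
  also have "\<dots> \<le> (\<integral>\<^sup>+x. ennreal (exp (lam * \<bar>c\<bar>)) * (ennreal (laplace_density lam x) * f (x - c)) \<partial>lborel)"
    using nonneg by (intro nn_integral_mono)
      (auto simp: mult.assoc[symmetric] * simp flip: ennreal_mult intro!: mult_right_mono ennreal_leI)
  also have "\<dots> = ennreal (exp (lam * \<bar>c\<bar>)) * (\<integral>\<^sup>+x. f (x - c) \<partial>laplace lam)"
    by (subst nn_integral_cmult) (auto simp: nn_integral_density)
  finally show ?thesis .
qed

text \<open>The one-dimensional cost multiplies up coordinate by coordinate. The shifted point is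
  restricted to \<open>I\<close> so that it stays in the extensional product space.\<close>

lemma nn_integral_PiM_laplace_shift:
  assumes "0 < lam" "finite I" and f: "f \<in> borel_measurable (PiM I (\<lambda>_. borel))"
  shows "(\<integral>\<^sup>+x. f x \<partial>PiM I (\<lambda>_. laplace lam))
    \<le> ennreal (exp (lam * l1norm I c)) * (\<integral>\<^sup>+x. f (\<lambda>j\<in>I. x j - c j) \<partial>PiM I (\<lambda>_. laplace lam))"
  using assms(2) f
proof (induction I arbitrary: f rule: finite_induct)
  case empty
  show ?case
    by (simp add: PiM_empty nn_integral_count_space_finite l1norm_def)
next
  case (insert i I)
  interpret product_sigma_finite "\<lambda>_::nat. laplace lam"
    using prob_space_laplace[OF assms(1)]
    by (simp add: product_sigma_finite_def prob_space_imp_sigma_finite)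
  have sets_eq: "sets (PiM J (\<lambda>_. laplace lam)) = sets (PiM J (\<lambda>_. borel))" for J :: "nat set"
    by (intro sets_PiM_cong) auto
  have [measurable]: "f \<in> borel_measurable (PiM (insert i I) (\<lambda>_. laplace lam))"
    using insert.prems measurable_cong_sets[OF sets_eq refl] by blast
  have [measurable]: "f \<in> borel_measurable (PiM (insert i I) (\<lambda>_. borel))"
    by fact
  have m1: "(\<lambda>y. f (x(i := y))) \<in> borel_measurable borel" if "x \<in> space (PiM I (\<lambda>_. laplace lam))" for x
  proof -
    have "x \<in> space (PiM I (\<lambda>_. borel))"
      using that by (simp add: space_PiM)
    then show ?thesis by measurable
  qed
  have m2: "(\<lambda>(x, y). f (x(i := y - c i))) \<in> borel_measurable (PiM I (\<lambda>_. borel) \<Otimes>\<^sub>M borel)"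
    by measurable
  have m3: "(\<lambda>x. \<integral>\<^sup>+y. f (x(i := y - c i)) \<partial>laplace lam) \<in> borel_measurable (PiM I (\<lambda>_. borel))"
    using m2 by measurable
  have m4: "(\<lambda>x. \<integral>\<^sup>+y. f (x(i := y - c i)) \<partial>laplace lam) \<in> borel_measurable (PiM I (\<lambda>_. laplace lam))"
    using m3 measurable_cong_sets[OF sets_eq refl] by blast
  have shift_meas: "(\<lambda>x. \<lambda>j\<in>insert i I. x j - c j) \<in> measurable (PiM (insert i I) (\<lambda>_. laplace lam)) (PiM (insert i I) (\<lambda>_. laplace lam))"
    by measurable
  have "(\<integral>\<^sup>+x. f x \<partial>PiM (insert i I) (\<lambda>_. laplace lam))
      = (\<integral>\<^sup>+x. \<integral>\<^sup>+y. f (x(i := y)) \<partial>laplace lam \<partial>PiM I (\<lambda>_. laplace lam))"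
    using insert.hyps by (intro product_nn_integral_insert) auto
  also have "\<dots> \<le> (\<integral>\<^sup>+x. ennreal (exp (lam * \<bar>c i\<bar>)) * (\<integral>\<^sup>+y. f (x(i := y - c i)) \<partial>laplace lam) \<partial>PiM I (\<lambda>_. laplace lam))"
    using m1 by (intro nn_integral_mono nn_integral_laplace_shift assms(1)) auto
  also have "\<dots> = ennreal (exp (lam * \<bar>c i\<bar>)) * (\<integral>\<^sup>+x. (\<integral>\<^sup>+y. f (x(i := y - c i)) \<partial>laplace lam) \<partial>PiM I (\<lambda>_. laplace lam))"
    by (intro nn_integral_cmult m4)
  also have "\<dots> \<le> ennreal (exp (lam * \<bar>c i\<bar>)) * (ennreal (exp (lam * l1norm I c)) *
      (\<integral>\<^sup>+x. (\<integral>\<^sup>+y. f ((\<lambda>j\<in>I. x j - c j)(i := y - c i)) \<partial>laplace lam) \<partial>PiM I (\<lambda>_. laplace lam)))"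
    by (intro mult_left_mono insert.IH m3) auto
  also have "(\<integral>\<^sup>+x. (\<integral>\<^sup>+y. f ((\<lambda>j\<in>I. x j - c j)(i := y - c i)) \<partial>laplace lam) \<partial>PiM I (\<lambda>_. laplace lam))
     = (\<integral>\<^sup>+x. (\<integral>\<^sup>+y. f (\<lambda>j\<in>insert i I. (x(i := y)) j - c j) \<partial>laplace lam) \<partial>PiM I (\<lambda>_. laplace lam))"
    using insert.hyps by (intro nn_integral_cong arg_cong[where f=f]) (auto simp: fun_eq_iff)
  also have "\<dots> = (\<integral>\<^sup>+x. f (\<lambda>j\<in>insert i I. x j - c j) \<partial>PiM (insert i I) (\<lambda>_. laplace lam))"
    using insert.hyps shift_meas
    by (intro product_nn_integral_insert[symmetric]) auto
  also have "ennreal (exp (lam * \<bar>c i\<bar>)) * (ennreal (exp (lam * l1norm I c)) * T)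
     = ennreal (exp (lam * l1norm (insert i I) c)) * T" for T
    using insert.hyps by (simp add: l1norm_def distrib_left exp_add ennreal_mult mult.assoc)
  finally show ?case .
qed

text \<open>Independence reduces this to one coordinate, where completing the square turns the
  tilted standard normal density into the normal density with mean \<open>a\<close>.\<close>

lemma noise_mgf:
  "(\<integral>\<^sup>+\<epsilon>. ennreal (exp (dotp n \<epsilon> x)) \<partial>noise n) = ennreal (exp ((l2norm n x)\<^sup>2 / 2))"
proof -
  have prob: "prob_space (density lborel std_normal_density)"
    by (rule prob_space_normal_density) simp
  interpret product_sigma_finite "\<lambda>_::nat. density lborel std_normal_density"
    using prob by (simp add: product_sigma_finite_def prob_space_imp_sigma_finite)
  have one: "(\<integral>\<^sup>+z. ennreal (exp (z * a)) \<partial>density lborel std_normal_density) = ennreal (exp (a\<^sup>2 / 2))" for a :: real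
  proof -
    have "(\<integral>\<^sup>+z. ennreal (exp (z * a)) \<partial>density lborel std_normal_density)
        = (\<integral>\<^sup>+z. ennreal (exp (a\<^sup>2 / 2)) * ennreal (normal_density a 1 z) \<partial>lborel)"
      by (subst nn_integral_density)
        (auto simp: normal_density_def field_simps power2_eq_square simp flip: ennreal_mult exp_add intro!: nn_integral_cong)
    also have "\<dots> = ennreal (exp (a\<^sup>2 / 2)) * emeasure (density lborel (normal_density a 1)) UNIV"
      by (subst nn_integral_cmult) (auto simp: emeasure_density)
    also have "emeasure (density lborel (normal_density a 1)) UNIV = 1"
      using prob_space.emeasure_space_1[OF prob_space_normal_density[of 1 a]] by simp
    finally show ?thesis by simp
  qed
  have "(\<integral>\<^sup>+\<epsilon>. ennreal (exp (dotp n \<epsilon> x)) \<partial>noise n)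
      = (\<integral>\<^sup>+\<epsilon>. (\<Prod>i<n. ennreal (exp (\<epsilon> i * x i))) \<partial>noise n)"
    by (simp add: dotp_def exp_sum prod_ennreal)
  also have "\<dots> = (\<Prod>i<n. \<integral>\<^sup>+z. ennreal (exp (z * x i)) \<partial>density lborel std_normal_density)"
    unfolding noise_def by (rule product_nn_integral_prod) auto
  also have "\<dots> = ennreal (exp ((l2norm n x)\<^sup>2 / 2))"
    by (simp add: one prod_ennreal exp_sum l2norm_def sum_nonneg sum_divide_distrib)
  finally show ?thesis .
qed

lemma prob_space_noise: "prob_space (noise n)"
  unfolding noise_def by (intro prob_space_PiM prob_space_normal_density) simp

section \<open>Prior on a fixed model and likelihood\<close>

text \<open>The factors of \<open>prior_comp\<close> under a name of their own, so that products
  over only a part of the coordinates can be formed.\<close>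

definition coord_prior :: "real \<Rightarrow> nat set \<Rightarrow> nat \<Rightarrow> real measure" where
  "coord_prior lam S j = (if j \<in> S then laplace lam else return lborel 0)"

lemma prior_comp_eq: "prior_comp p lam S = PiM {..<p} (coord_prior lam S)"
  by (simp add: prior_comp_def coord_prior_def[abs_def])

lemma sets_coord_prior [measurable_cong]: "sets (coord_prior lam S j) = sets borel"
  by (simp add: coord_prior_def)

lemma prob_space_coord_prior: "0 < lam \<Longrightarrow> prob_space (coord_prior lam S j)"
  by (simp add: coord_prior_def prob_space_laplace prob_space_return)

lemma prob_space_prior_comp: "0 < lam \<Longrightarrow> prob_space (prior_comp p lam S)"
  unfolding prior_comp_eq by (intro prob_space_PiM prob_space_coord_prior)

lemma product_sigma_finite_coord_prior:
  "0 < lam \<Longrightarrow> product_sigma_finite (coord_prior lam S)"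
  by (simp add: product_sigma_finite_def prob_space_coord_prior prob_space_imp_sigma_finite)

lemma sets_PiM_coord_prior [measurable_cong]:
  "sets (PiM I (coord_prior lam S)) = sets (PiM I (\<lambda>_. borel))"
  by (intro sets_PiM_cong sets_coord_prior refl)

text \<open>The point masses off \<open>S\<close> act twice later: model \<open>S\<close> gives no
  mass to vectors whose support leaves \<open>S\<close>, and in the true model the integral over the
  remaining coordinates collapses to the value at 0.\<close>

lemma AE_coord_prior_zero:
  assumes "0 < lam" "finite I"
  shows "AE y in PiM I (coord_prior lam S). \<forall>j\<in>I - S. y j = 0"
proof (subst AE_ball_countable)
  show "\<forall>j\<in>I - S. AE y in PiM I (coord_prior lam S). y j = 0"
  proof
    fix j assume j: "j \<in> I - S"
    have "AE x in return lborel 0. x = (0::real)"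
      by (subst AE_return) auto
    moreover have "return lborel 0 = coord_prior lam S j"
      using j by (simp add: coord_prior_def)
    ultimately have "AE x in coord_prior lam S j. x = 0"
      by (rule back_subst)
    with j show "AE y in PiM I (coord_prior lam S). y j = 0"
      by (intro AE_PiM_component prob_space_coord_prior assms(1)) auto
  qed
qed (use assms in \<open>auto intro: countable_finite\<close>)

text \<open>By independence each Laplace coordinate contributes
  \<open>lam / (lam - lam / 2) = 2\<close> and each point mass at 0 contributes 1.\<close>

lemma nn_integral_coord_prior_exp:
  assumes "0 < lam" "finite I"
  shows "(\<integral>\<^sup>+y. ennreal (exp (lam / 2 * l1norm I y)) \<partial>PiM I (coord_prior lam S)) = 2 ^ card (I \<inter> S)"
proof -
  interpret product_sigma_finite "coord_prior lam S"
    by (rule product_sigma_finite_coord_prior[OF assms(1)])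
  have one: "(\<integral>\<^sup>+x. ennreal (exp (lam / 2 * \<bar>x\<bar>)) \<partial>coord_prior lam S j) = (if j \<in> S then 2 else 1)" for j
    using nn_integral_laplace_exp[OF assms(1), of "lam / 2"] assms(1)
    by (simp add: coord_prior_def nn_integral_return)
  have "(\<integral>\<^sup>+y. ennreal (exp (lam / 2 * l1norm I y)) \<partial>PiM I (coord_prior lam S))
      = (\<integral>\<^sup>+y. (\<Prod>j\<in>I. ennreal (exp (lam / 2 * \<bar>y j\<bar>))) \<partial>PiM I (coord_prior lam S))"
    using assms(2) by (simp add: l1norm_def sum_distrib_left exp_sum prod_ennreal)
  also have "\<dots> = (\<Prod>j\<in>I. \<integral>\<^sup>+x. ennreal (exp (lam / 2 * \<bar>x\<bar>)) \<partial>coord_prior lam S j)"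
    by (intro product_nn_integral_prod assms(2)) auto
  also have "\<dots> = (\<Prod>j\<in>I \<inter> S. 2)"
    unfolding one by (rule prod.inter_restrict[OF assms(2), symmetric])
  finally show ?thesis by simp
qed

text \<open>Fubini with the coordinates of \<open>S0\<close> innermost: they are to be shifted, by
  an amount depending on the remaining coordinates.\<close>

lemma nn_integral_prior_comp_split:
  assumes "0 < lam" "S0 \<subseteq> S" "S0 \<subseteq> {..<p}" and f: "f \<in> borel_measurable (PiM {..<p} (\<lambda>_. borel))"
  shows "(\<integral>\<^sup>+\<beta>. f \<beta> \<partial>prior_comp p lam S)
    = (\<integral>\<^sup>+y. \<integral>\<^sup>+x. f (merge ({..<p} - S0) S0 (y, x)) \<partial>PiM S0 (\<lambda>_. laplace lam)
         \<partial>PiM ({..<p} - S0) (coord_prior lam S))"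
proof -
  interpret product_sigma_finite "coord_prior lam S"
    by (rule product_sigma_finite_coord_prior[OF assms(1)])
  have un: "{..<p} = ({..<p} - S0) \<union> S0"
    using assms by auto
  have lap: "PiM S0 (coord_prior lam S) = PiM S0 (\<lambda>_. laplace lam)"
    using assms by (intro PiM_cong) (auto simp: coord_prior_def)
  have "f \<in> borel_measurable (PiM {..<p} (coord_prior lam S))"
    using f measurable_cong_sets[OF sets_PiM_coord_prior refl] by blast
  then show ?thesis
    unfolding prior_comp_eq lap[symmetric]
    by (subst un, intro product_nn_integral_fold)
       (use assms un finite_subset[OF assms(3)] in auto)
qed

lemma likelihood_dotp:
  "likelihood n p X Y \<beta> =
    exp (- (dotp n (\<lambda>i. Y i - matvec p X \<beta> i) (\<lambda>i. Y i - matvec p X \<beta> i) / 2))"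
  by (simp add: likelihood_def l2norm_square)

lemma likelihood_pos: "0 < likelihood n p X Y \<beta>"
  and likelihood_le_1: "likelihood n p X Y \<beta> \<le> 1"
  by (simp_all add: likelihood_def)

lemma matvec_measurable [measurable]:
  "(\<lambda>\<beta>. matvec p X \<beta> i) \<in> borel_measurable (PiM {..<p} (\<lambda>_. borel))"
  unfolding matvec_def by measurable

lemma likelihood_measurable [measurable]:
  "likelihood n p X Y \<in> borel_measurable (PiM {..<p} (\<lambda>_. borel))"
  unfolding likelihood_dotp[abs_def] dotp_def by measurable

lemma integrable_likelihood:
  assumes "0 < lam"
  shows "integrable (prior_comp p lam S) (likelihood n p X Y)"
proof -
  interpret prob_space "prior_comp p lam S"
    by (rule prob_space_prior_comp[OF assms])
  have "likelihood n p X Y \<in> borel_measurable (prior_comp p lam S)"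
    unfolding prior_comp_eq
    using likelihood_measurable measurable_cong_sets[OF sets_PiM_coord_prior refl] by blast
  then show ?thesis
    by (intro integrable_const_bound[of _ 1])
       (auto simp: likelihood_le_1 less_imp_le[OF likelihood_pos])
qed

text \<open>The integrand is strictly positive on a probability space; this is what makes dividing
  by marginal likelihoods legitimate.\<close>

lemma integral_likelihood_pos:
  assumes "0 < lam"
  shows "0 < (\<integral>\<beta>. likelihood n p X Y \<beta> \<partial>prior_comp p lam S)"
proof -
  interpret prob_space "prior_comp p lam S"
    by (rule prob_space_prior_comp[OF assms])
  show ?thesis
    using integral_less_AE_space[OF integrable_zero integrable_likelihood[OF assms]]
    by (simp add: likelihood_pos emeasure_space_1)
qed

text \<open>Only coordinates below \<open>p\<close> are compared, since the vectors built with
  \<open>merge\<close> are \<open>undefined\<close> elsewhere.\<close>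

lemma matvec_add_coords:
  "(\<forall>j<p. \<beta> j = u j + v j) \<Longrightarrow> matvec p X \<beta> i = matvec p X u i + matvec p X v i"
  by (simp add: matvec_def algebra_simps sum.distrib)

section \<open>Posterior mass of strict supersets\<close>

text \<open>The prior probability that exactly the model \<open>S\<close> is drawn.\<close>

definition sel_weight :: "nat \<Rightarrow> (nat \<Rightarrow> real) \<Rightarrow> nat set \<Rightarrow> real" where
  "sel_weight p prs S = prs (card S) / real (p choose card S)"

text \<open>In the numerator only models strictly containing \<open>S0\<close> contribute, each at
  most its full marginal likelihood \<open>R S\<close>; from the denominator only the term of
  \<open>S0\<close> is kept.\<close>

lemma posterior_superset_le:
  fixes n p :: nat and X :: "nat \<Rightarrow> nat \<Rightarrow> real" and lam :: real and Y :: "nat \<Rightarrow> real"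
    and prs :: "nat \<Rightarrow> real" and S0 :: "nat set"
  defines "B \<equiv> {\<beta>. S0 \<subset> supp p \<beta>}"
  defines "R \<equiv> \<lambda>S. \<integral>\<beta>. likelihood n p X Y \<beta> \<partial>prior_comp p lam S"
  assumes lam: "0 < lam" and prs: "\<forall>t\<le>p. 0 \<le> prs t"
    and S0: "S0 \<subseteq> {..<p}" "0 < prs (card S0)"
  shows "posterior n p X lam prs B Y \<le> 1"
    and "posterior n p X lam prs B Y
      \<le> (\<Sum>S\<in>{S. S0 \<subset> S \<and> S \<subseteq> {..<p}}. sel_weight p prs S / sel_weight p prs S0 * (R S / R S0))"
    and "0 \<le> posterior n p X lam prs B Y"
proof -
  define N where "N = (\<lambda>S. \<integral>\<beta>. indicator B \<beta> * likelihood n p X Y \<beta> \<partial>prior_comp p lam S)"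
  define w where "w = sel_weight p prs"
  have post: "posterior n p X lam prs B Y = (\<Sum>S\<in>Pow {..<p}. w S * N S) / (\<Sum>S\<in>Pow {..<p}. w S * R S)"
    by (simp add: posterior_def prior_int_def N_def R_def w_def sel_weight_def)
  have w: "0 \<le> w S" if "S \<subseteq> {..<p}" for S
    using that prs card_mono[of "{..<p}" S] by (simp add: w_def sel_weight_def)
  have cS0: "card S0 \<le> p"
    using card_mono[of "{..<p}" S0] S0 by simp
  have w0: "0 < w S0"
    using S0 cS0 by (simp add: w_def sel_weight_def)
  have R: "0 < R S" for S
    unfolding R_def by (rule integral_likelihood_pos[OF lam])
  have N0: "0 \<le> N S" for S
    unfolding N_def by (intro integral_nonneg_AE) (simp add: less_imp_le[OF likelihood_pos])
  have NR: "N S \<le> R S" for S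
  proof (cases "integrable (prior_comp p lam S) (\<lambda>\<beta>. indicator B \<beta> * likelihood n p X Y \<beta>)")
    case True
    then show ?thesis
      unfolding N_def R_def
      by (intro integral_mono integrable_likelihood lam)
         (auto simp: indicator_def less_imp_le[OF likelihood_pos])
  next
    \<comment> \<open>A non-integrable function has Bochner integral 0, so the bound follows from
      \<open>0 < R S\<close> and the measurability of \<open>B\<close> need not be settled.\<close>
    case False
    then show ?thesis
      using R[of S] by (simp add: N_def not_integrable_integral_eq)
  qed
  \<comment> \<open>Under model \<open>S\<close> the support lies in \<open>S\<close> almost surely,
    so a vector in \<open>B\<close> would force \<open>S0 \<subset> S\<close>.\<close>
  have Nz: "N S = 0" if "\<not> S0 \<subset> S" for S
  proof -
    have "AE \<beta> in prior_comp p lam S. indicator B \<beta> * likelihood n p X Y \<beta> = 0"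
      unfolding prior_comp_eq
    proof (use AE_coord_prior_zero[OF lam, of "{..<p}" S, OF finite_lessThan] in eventually_elim)
      case (elim \<beta>)
      then have "supp p \<beta> \<subseteq> S"
        by (auto simp: supp_def)
      with that have "\<beta> \<notin> B"
        by (auto simp: B_def)
      then show ?case by simp
    qed
    then show ?thesis
      unfolding N_def by (rule integral_eq_zero_AE)
  qed
  have den: "w S0 * R S0 \<le> (\<Sum>S\<in>Pow {..<p}. w S * R S)"
    using S0 w R by (intro member_le_sum) (auto intro!: mult_nonneg_nonneg less_imp_le[OF R])
  have den0: "0 < w S0 * R S0"
    using w0 R by simp
  have num_le: "(\<Sum>S\<in>Pow {..<p}. w S * N S) \<le> (\<Sum>S\<in>Pow {..<p}. w S * R S)"
    using w NR by (intro sum_mono mult_left_mono) auto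
  show "posterior n p X lam prs B Y \<le> 1"
    unfolding post using num_le den den0 by (simp add: divide_le_eq_1)
  show "0 \<le> posterior n p X lam prs B Y"
    unfolding post using w N0 less_imp_le[OF R] by (intro divide_nonneg_nonneg sum_nonneg mult_nonneg_nonneg) auto
  have "(\<Sum>S\<in>Pow {..<p}. w S * N S) = (\<Sum>S\<in>{S. S0 \<subset> S \<and> S \<subseteq> {..<p}}. w S * N S)"
  proof (rule sum.mono_neutral_right)
    show "\<forall>S\<in>Pow {..<p} - {S. S0 \<subset> S \<and> S \<subseteq> {..<p}}. w S * N S = 0"
    proof
      fix S assume "S \<in> Pow {..<p} - {S. S0 \<subset> S \<and> S \<subseteq> {..<p}}"
      then have "\<not> S0 \<subset> S" by blast
      then have "N S = 0" by (rule Nz)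
      then show "w S * N S = 0" by simp
    qed
  qed auto
  also have "\<dots> \<le> (\<Sum>S\<in>{S. S0 \<subset> S \<and> S \<subseteq> {..<p}}. w S * R S)"
    using w NR by (intro sum_mono mult_left_mono) auto
  finally have num: "(\<Sum>S\<in>Pow {..<p}. w S * N S) \<le> (\<Sum>S\<in>{S. S0 \<subset> S \<and> S \<subseteq> {..<p}}. w S * R S)" .
  have "posterior n p X lam prs B Y \<le> (\<Sum>S\<in>{S. S0 \<subset> S \<and> S \<subseteq> {..<p}}. w S * R S) / (w S0 * R S0)"
    unfolding post using num den den0 w R
    by (intro frac_le) (auto intro!: sum_nonneg mult_nonneg_nonneg less_imp_le[OF R])
  then show "posterior n p X lam prs B Y
      \<le> (\<Sum>S\<in>{S. S0 \<subset> S \<and> S \<subseteq> {..<p}}. sel_weight p prs S / sel_weight p prs S0 * (R S / R S0))"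
    by (simp add: sum_divide_distrib w_def)
qed

section \<open>Compatibility inequality and orthogonal shift\<close>

text \<open>Inside the cone of \<open>compat\<close> the infimum bounds \<open>l1norm S v\<close> by
  the second summand; outside it, the failed cone condition gives the first one, whence the 7. The
  sum of the two holds for every \<open>v\<close>.\<close>

lemma compat_bound:
  assumes "ereal c0 \<le> compat n p X S" "0 < c0" "0 < Xnorm n p X" "finite S"
  shows "l1norm S v \<le> l1norm ({..<p} - S) v / 7
     + l2norm n (matvec p X v) * sqrt (real (card S)) / (c0 * Xnorm n p X)"
proof -
  have nn: "0 \<le> l1norm A v" for A
    by (simp add: l1norm_def sum_nonneg)
  have t: "0 \<le> l2norm n (matvec p X v) * sqrt (real (card S)) / (c0 * Xnorm n p X)"
    using assms by (simp add: l2norm_nonneg)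
  consider "l1norm S v = 0" | "l1norm ({..<p} - S) v > 7 * l1norm S v"
    | "l1norm S v > 0" "l1norm ({..<p} - S) v \<le> 7 * l1norm S v"
    using nn[of S] by linarith
  then show ?thesis
  proof cases
    case 1
    then show ?thesis using t nn[of "{..<p} - S"] by simp
  next
    case 2
    then show ?thesis using t by simp
  next
    case 3
    have "\<exists>j\<in>S. v j \<noteq> 0"
    proof (rule ccontr)
      assume "\<not> ?thesis"
      then have "l1norm S v = 0" by (simp add: l1norm_def)
      with 3 show False by simp
    qed
    then have "compat n p X S
        \<le> ereal (l2norm n (matvec p X v) * sqrt (real (card S)) / (Xnorm n p X * l1norm S v))"
      unfolding compat_def using 3 by (intro INF_lower) simp
    with assms(1) have "c0 \<le> l2norm n (matvec p X v) * sqrt (real (card S)) / (Xnorm n p X * l1norm S v)"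
      by (metis ereal_less_eq(3) order_trans)
    then have "l1norm S v \<le> l2norm n (matvec p X v) * sqrt (real (card S)) / (c0 * Xnorm n p X)"
      using 3 assms by (simp add: field_simps)
    then show ?thesis
      using nn[of "{..<p} - S"] by simp
  qed
qed

text \<open>Shifting the \<open>S\<^sub>0\<close>-coordinates by the coefficients of the projection of the other columns
  on the span of the columns in \<open>S\<^sub>0\<close> makes the two parts of the model orthogonal.\<close>

locale column_projection =
  fixes n p :: nat and X :: "nat \<Rightarrow> nat \<Rightarrow> real" and lam :: real
    and \<beta>0 :: "nat \<Rightarrow> real" and S0 K :: "nat set" and G :: "nat \<Rightarrow> nat \<Rightarrow> real"
  defines "S0 \<equiv> supp p \<beta>0" and "K \<equiv> {..<p} - supp p \<beta>0"
  assumes lam: "0 < lam"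
    and G: "\<And>l i. i \<in> S0 \<Longrightarrow>
      dotp n (\<lambda>m. X m i) (\<lambda>m. X m l - (\<Sum>j\<in>S0. G l j * X m j)) = 0"
begin

text \<open>The coefficients, with respect to the columns in \<open>S0\<close>, of the projection of
  the \<open>y\<close>-combination of the columns in \<open>K\<close>.\<close>

definition shift :: "(nat \<Rightarrow> real) \<Rightarrow> nat \<Rightarrow> real" where
  "shift y = (\<lambda>j. \<Sum>l\<in>K. y l * G l j)"

text \<open>A coefficient vector whose image \<open>fit y\<close> is the part of the
  \<open>y\<close>-combination orthogonal to the \<open>S0\<close>-columns. Having it as a vector in
  the full parameter space makes the compatibility condition applicable to it.\<close>

definition resid :: "(nat \<Rightarrow> real) \<Rightarrow> nat \<Rightarrow> real" where
  "resid y = (\<lambda>j. if j \<in> S0 then - shift y j else y j)"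

abbreviation fit :: "(nat \<Rightarrow> real) \<Rightarrow> nat \<Rightarrow> real" where
  "fit y \<equiv> matvec p X (resid y)"

abbreviation obs :: "(nat \<Rightarrow> real) \<Rightarrow> nat \<Rightarrow> real" where
  "obs \<epsilon> \<equiv> \<lambda>i. matvec p X \<beta>0 i + \<epsilon> i"

definition evidence :: "nat set \<Rightarrow> (nat \<Rightarrow> real) \<Rightarrow> real" where
  "evidence S \<epsilon> = (\<integral>\<beta>. likelihood n p X (obs \<epsilon>) \<beta> \<partial>prior_comp p lam S)"

lemma S0_sub: "S0 \<subseteq> {..<p}" and fin_S0: "finite S0" and fin_K: "finite K"
  and S0_K: "S0 \<inter> K = {}" "S0 \<union> K = {..<p}" and K_eq: "K = {..<p} - S0"
  by (auto simp: S0_def K_def supp_def)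

lemma fit_eq: "fit y m = (\<Sum>l\<in>K. y l * (X m l - (\<Sum>j\<in>S0. G l j * X m j)))"
proof -
  have "fit y m = (\<Sum>j\<in>S0. X m j * resid y j) + (\<Sum>j\<in>K. X m j * resid y j)"
    unfolding matvec_def S0_K(2)[symmetric] using S0_K(1) fin_S0 fin_K
    by (simp add: sum.union_disjoint)
  also have "(\<Sum>j\<in>K. X m j * resid y j) = (\<Sum>l\<in>K. y l * X m l)"
    using S0_K(1) by (intro sum.cong) (auto simp: resid_def)
  also have "(\<Sum>j\<in>S0. X m j * resid y j) = - (\<Sum>j\<in>S0. \<Sum>l\<in>K. y l * (G l j * X m j))"
    unfolding sum_negf[symmetric] resid_def shift_def
    by (intro sum.cong) (auto simp: sum_distrib_left sum_negf[symmetric] algebra_simps)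
  also have "\<dots> = - (\<Sum>l\<in>K. \<Sum>j\<in>S0. y l * (G l j * X m j))"
    by (subst sum.swap) simp
  finally show ?thesis
    by (simp add: algebra_simps sum_subtractf sum_distrib_left)
qed

lemma fit_orthogonal:
  assumes "i \<in> S0"
  shows "dotp n (fit y) (\<lambda>m. X m i) = 0"
proof -
  have "fit y = (\<lambda>m. \<Sum>l\<in>K. y l * (X m l - (\<Sum>j\<in>S0. G l j * X m j)))"
    by (rule ext) (rule fit_eq)
  then have "dotp n (fit y) (\<lambda>m. X m i)
     = (\<Sum>l\<in>K. dotp n (\<lambda>m. y l * (X m l - (\<Sum>j\<in>S0. G l j * X m j))) (\<lambda>m. X m i))"
    by (simp add: dotp_sum_left)
  also have "\<dots> = 0"
    using G[OF assms] by (simp only: dotp_commute[of _ _ "\<lambda>m. X m i"] dotp_scale_right) simp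
  finally show ?thesis .
qed

text \<open>After the shift the mean is that of \<open>b\<close>, supported in \<open>S0\<close>,
  plus \<open>fit y\<close>. In the cross term of the expanded square only the noise survives,
  because \<open>\<beta>0 - b\<close> is supported in \<open>S0\<close> and \<open>fit y\<close> is
  orthogonal to the columns there.\<close>

lemma likelihood_shift:
  "likelihood n p X (obs \<epsilon>) (merge K S0 (y, \<lambda>j\<in>S0. x j - shift y j))
    = exp (dotp n \<epsilon> (fit y) - (l2norm n (fit y))\<^sup>2 / 2)
      * likelihood n p X (obs \<epsilon>) (merge K S0 (\<lambda>_. 0, x))"
proof -
  define b where "b = merge K S0 (\<lambda>_. 0::real, x)"
  define r where "r = (\<lambda>i. obs \<epsilon> i - matvec p X b i)"
  have split: "matvec p X (merge K S0 (y, \<lambda>j\<in>S0. x j - shift y j)) i = matvec p X b i + fit y i" for i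
    using S0_K by (intro matvec_add_coords) (auto simp: b_def resid_def merge_def)
  have "dotp n r (fit y) = dotp n \<epsilon> (fit y) + dotp n (matvec p X (\<lambda>j. \<beta>0 j - b j)) (fit y)"
  proof -
    have "r = (\<lambda>i. \<epsilon> i + matvec p X (\<lambda>j. \<beta>0 j - b j) i)"
      by (simp add: r_def matvec_def algebra_simps sum_subtractf)
    then show ?thesis by (simp add: dotp_add_left)
  qed
  also have "dotp n (matvec p X (\<lambda>j. \<beta>0 j - b j)) (fit y)
      = (\<Sum>j<p. (\<beta>0 j - b j) * dotp n (fit y) (\<lambda>m. X m j))"
    by (subst dotp_commute) (rule dotp_matvec)
  also have "\<dots> = 0"
  proof (rule sum.neutral, intro ballI)
    fix j assume j: "j \<in> {..<p}"
    show "(\<beta>0 j - b j) * dotp n (fit y) (\<lambda>m. X m j) = 0"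
    proof (cases "j \<in> S0")
      case False
      then have "\<beta>0 j = 0" "b j = 0"
        using j by (auto simp: S0_def K_def supp_def b_def merge_def)
      then show ?thesis by simp
    qed (simp add: fit_orthogonal)
  qed
  finally have cross: "dotp n r (fit y) = dotp n \<epsilon> (fit y)" by simp
  have r_fit: "(\<lambda>i. obs \<epsilon> i - matvec p X (merge K S0 (y, \<lambda>j\<in>S0. x j - shift y j)) i) = (\<lambda>i. r i - fit y i)"
    by (simp only: split r_def) (simp add: algebra_simps)
  have sq: "dotp n (\<lambda>i. r i - fit y i) (\<lambda>i. r i - fit y i)
      = dotp n r r - 2 * dotp n r (fit y) + dotp n (fit y) (fit y)"
    by (simp add: dotp_def algebra_simps sum.distrib sum_subtractf sum_distrib_left sum_distrib_right)
  show ?thesis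
    unfolding likelihood_dotp r_fit sq cross b_def[symmetric] r_def[symmetric] l2norm_square exp_add[symmetric]
    by (simp add: field_simps)
qed

lemma fit_measurable [measurable]: "(\<lambda>y. fit y m) \<in> borel_measurable (PiM K (\<lambda>_. borel))"
  unfolding fit_eq using fin_K by measurable

lemma shift_measurable [measurable]: "(\<lambda>y. shift y j) \<in> borel_measurable (PiM K (\<lambda>_. borel))"
  unfolding shift_def by measurable

lemma ennreal_evidence:
  "ennreal (evidence S \<epsilon>) = (\<integral>\<^sup>+\<beta>. ennreal (likelihood n p X (obs \<epsilon>) \<beta>) \<partial>prior_comp p lam S)"
  unfolding evidence_def
  by (intro nn_integral_eq_integral[symmetric] integrable_likelihood lam AE_I2 less_imp_le likelihood_pos)

text \<open>For fixed \<open>y\<close>, the Laplace shift costs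
  \<open>exp (lam * l1norm S0 (shift y))\<close> and \<open>likelihood_shift\<close> pulls the
  remaining dependence on \<open>y\<close> out of the inner integral. What is left is the same
  \<open>?D\<close> for all \<open>y\<close>.\<close>

lemma evidence_le:
  assumes "S0 \<subseteq> S"
  shows "ennreal (evidence S \<epsilon>) \<le> ennreal (evidence S0 \<epsilon>) *
    (\<integral>\<^sup>+y. ennreal (exp (lam * l1norm S0 (shift y) + dotp n \<epsilon> (fit y) - (l2norm n (fit y))\<^sup>2 / 2))
       \<partial>PiM K (coord_prior lam S))"
proof -
  let ?L = "\<lambda>\<beta>. ennreal (likelihood n p X (obs \<epsilon>) \<beta>)"
  let ?P = "PiM S0 (\<lambda>_. laplace lam)"
  let ?D = "\<integral>\<^sup>+x. ?L (merge K S0 (\<lambda>_. 0, x)) \<partial>?P"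
  have setsP: "sets ?P = sets (PiM S0 (\<lambda>_. borel))"
    by (intro sets_PiM_cong) auto
  have L_meas: "?L \<in> borel_measurable (PiM {..<p} (\<lambda>_. borel))"
    by measurable
  have merge_meas: "(\<lambda>x. merge K S0 (y, x)) \<in> measurable (PiM S0 (\<lambda>_. borel)) (PiM {..<p} (\<lambda>_. borel))"
    for y :: "nat \<Rightarrow> real"
  proof (rule measurable_PiM_single')
    fix j assume "j \<in> {..<p}"
    then show "(\<lambda>x. merge K S0 (y, x) j) \<in> borel_measurable (PiM S0 (\<lambda>_. borel))"
      using S0_K by (cases "j \<in> S0") (auto simp: merge_def)
  qed (use S0_K in \<open>auto simp: merge_def space_PiM PiE_def extensional_def\<close>)
  have comp_meas: "(\<lambda>x. ?L (merge K S0 (y, x))) \<in> borel_measurable (PiM S0 (\<lambda>_. borel))" for y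
    using measurable_compose[OF merge_meas L_meas] .
  have comp_meas': "(\<lambda>x. ?L (merge K S0 (y, x))) \<in> borel_measurable ?P" for y
    using comp_meas measurable_cong_sets[OF setsP refl] by blast
  have inner: "(\<integral>\<^sup>+x. ?L (merge K S0 (y, x)) \<partial>?P)
    \<le> ennreal (exp (lam * l1norm S0 (shift y) + dotp n \<epsilon> (fit y) - (l2norm n (fit y))\<^sup>2 / 2)) * ?D" for y
  proof -
    have "(\<integral>\<^sup>+x. ?L (merge K S0 (y, x)) \<partial>?P) \<le> ennreal (exp (lam * l1norm S0 (shift y)))
      * (\<integral>\<^sup>+x. ?L (merge K S0 (y, \<lambda>j\<in>S0. x j - shift y j)) \<partial>?P)"
      by (rule nn_integral_PiM_laplace_shift[OF lam fin_S0 comp_meas])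
    also have "\<dots> = ennreal (exp (lam * l1norm S0 (shift y)))
      * (ennreal (exp (dotp n \<epsilon> (fit y) - (l2norm n (fit y))\<^sup>2 / 2)) * ?D)"
      unfolding likelihood_shift
      using comp_meas' by (simp add: ennreal_mult nn_integral_cmult less_imp_le[OF likelihood_pos])
    also have "\<dots> = ennreal (exp (lam * l1norm S0 (shift y) + dotp n \<epsilon> (fit y) - (l2norm n (fit y))\<^sup>2 / 2)) * ?D"
      by (simp add: mult.assoc[symmetric] add_diff_eq[symmetric] exp_add ennreal_mult)
    finally show ?thesis .
  qed
  \<comment> \<open>In model \<open>S0\<close> the coordinates \<open>y\<close> vanish almost
    surely, and they are integrated against a probability measure.\<close>
  have ev0: "ennreal (evidence S0 \<epsilon>) = ?D"
  proof -
    have "prob_space (PiM K (coord_prior lam S0))"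
      by (intro prob_space_PiM prob_space_coord_prior lam)
    then have one: "emeasure (PiM K (coord_prior lam S0)) (space (PiM K (coord_prior lam S0))) = 1"
      by (rule prob_space.emeasure_space_1)
    have "ennreal (evidence S0 \<epsilon>)
        = (\<integral>\<^sup>+y. \<integral>\<^sup>+x. ?L (merge K S0 (y, x)) \<partial>?P \<partial>PiM K (coord_prior lam S0))"
      unfolding ennreal_evidence K_eq
      by (rule nn_integral_prior_comp_split[OF lam order_refl S0_sub L_meas])
    also have "\<dots> = (\<integral>\<^sup>+y. ?D \<partial>PiM K (coord_prior lam S0))"
    proof (rule nn_integral_cong_AE, use AE_coord_prior_zero[OF lam fin_K, of S0] in eventually_elim)
      case (elim y)
      then have "merge K S0 (y, x) = merge K S0 (\<lambda>_. 0, x)" for x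
        using S0_K(1) by (auto simp: merge_def fun_eq_iff)
      then show ?case by simp
    qed
    finally show ?thesis by (simp add: one)
  qed
  have "ennreal (evidence S \<epsilon>)
      = (\<integral>\<^sup>+y. \<integral>\<^sup>+x. ?L (merge K S0 (y, x)) \<partial>?P \<partial>PiM K (coord_prior lam S))"
    unfolding ennreal_evidence K_eq
    by (rule nn_integral_prior_comp_split[OF lam assms S0_sub L_meas])
  also have "\<dots> \<le> (\<integral>\<^sup>+y. ennreal (exp (lam * l1norm S0 (shift y) + dotp n \<epsilon> (fit y) - (l2norm n (fit y))\<^sup>2 / 2)) * ?D
       \<partial>PiM K (coord_prior lam S))"
    by (intro nn_integral_mono inner)
  also have "\<dots> = (\<integral>\<^sup>+y. ennreal (exp (lam * l1norm S0 (shift y) + dotp n \<epsilon> (fit y) - (l2norm n (fit y))\<^sup>2 / 2))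
       \<partial>PiM K (coord_prior lam S)) * ?D"
    by (intro nn_integral_multc) (simp add: dotp_def l1norm_def l2norm_square)
  finally show ?thesis
    by (simp add: ev0 mult.commute)
qed

end

section \<open>Correlation of the noise with the columns\<close>

lemma column_norm_le:
  assumes "j < p"
  shows "l2norm n (\<lambda>m. X m j) \<le> Xnorm n p X"
  unfolding Xnorm_def using assms by (intro Max_ge) (auto simp: colnorm_def l2norm_def)

text \<open>Hoelder's inequality between the maximum norm and the \<open>l1norm\<close>.\<close>

lemma dotp_matvec_le:
  assumes "\<And>j. j < p \<Longrightarrow> \<bar>dotp n u (\<lambda>m. X m j)\<bar> \<le> b"
  shows "dotp n u (matvec p X v) \<le> b * l1norm {..<p} v"
proof -
  have "v j * dotp n u (\<lambda>m. X m j) \<le> b * \<bar>v j\<bar>" if "j < p" for j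
  proof -
    have "v j * dotp n u (\<lambda>m. X m j) \<le> \<bar>v j\<bar> * \<bar>dotp n u (\<lambda>m. X m j)\<bar>"
      by (metis abs_ge_self abs_mult)
    also have "\<dots> \<le> \<bar>v j\<bar> * b"
      using assms[OF that] by (intro mult_left_mono) auto
    finally show ?thesis by (simp add: mult.commute)
  qed
  then show ?thesis
    unfolding dotp_matvec l1norm_def sum_distrib_left by (intro sum_mono) auto
qed

text \<open>Chernoff weight dominating the indicator of the event that some column correlates with the
  noise by more than \<open>b\<close>.\<close>

definition tail_weight :: "nat \<Rightarrow> nat \<Rightarrow> (nat \<Rightarrow> nat \<Rightarrow> real) \<Rightarrow> real \<Rightarrow> real \<Rightarrow> (nat \<Rightarrow> real) \<Rightarrow> real" where
  "tail_weight n p X t b \<epsilon> = (\<Sum>j<p. exp (- (t * b)) * exp (dotp n \<epsilon> (\<lambda>m. t * X m j))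
      + exp (- (t * b)) * exp (dotp n \<epsilon> (\<lambda>m. - t * X m j)))"

text \<open>The inner product or its negative exceeds \<open>b\<close>, so one exponential in the
  \<open>j\<close>-th summand has nonnegative exponent; all other terms are positive.\<close>

lemma tail_weight_ge_1:
  assumes "0 \<le> t" "j < p" "b < \<bar>dotp n \<epsilon> (\<lambda>m. X m j)\<bar>"
  shows "1 \<le> tail_weight n p X t b \<epsilon>"
proof -
  have "t * b \<le> t * \<bar>dotp n \<epsilon> (\<lambda>m. X m j)\<bar>"
    using assms by (intro mult_left_mono) auto
  then have "t * b \<le> t * dotp n \<epsilon> (\<lambda>m. X m j) \<or> t * b \<le> - t * dotp n \<epsilon> (\<lambda>m. X m j)"
    by (auto simp: abs_if split: if_splits)
  then have "1 \<le> exp (- (t * b)) * exp (dotp n \<epsilon> (\<lambda>m. t * X m j))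
      + exp (- (t * b)) * exp (dotp n \<epsilon> (\<lambda>m. - t * X m j))"
  proof
    assume "t * b \<le> t * dotp n \<epsilon> (\<lambda>m. X m j)"
    then have "1 \<le> exp (- (t * b)) * exp (dotp n \<epsilon> (\<lambda>m. t * X m j))"
      by (simp add: dotp_scale_right flip: exp_add)
    then show ?thesis by (simp add: add_increasing2)
  next
    assume "t * b \<le> - t * dotp n \<epsilon> (\<lambda>m. X m j)"
    then have "1 \<le> exp (- (t * b)) * exp (dotp n \<epsilon> (\<lambda>m. - t * X m j))"
      by (simp only: dotp_scale_right) (simp flip: exp_add)
    then show ?thesis by (simp add: add_increasing)
  qed
  also have "\<dots> \<le> tail_weight n p X t b \<epsilon>"
    unfolding tail_weight_def using assms(2)
    by (intro member_le_sum) auto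
  finally show ?thesis .
qed

lemma dotp_noise_measurable [measurable]: "(\<lambda>\<epsilon>. dotp n \<epsilon> x) \<in> borel_measurable (noise n)"
  unfolding dotp_def noise_def by measurable

text \<open>There are \<open>2 * p\<close> Gaussian exponentials, each with variance at most
  \<open>t\<^sup>2 * (Xnorm n p X)\<^sup>2\<close>. The parameter \<open>t\<close> stays free and is
  optimized later.\<close>

lemma nn_integral_tail_weight:
  "(\<integral>\<^sup>+\<epsilon>. ennreal (tail_weight n p X t b \<epsilon>) \<partial>noise n)
    \<le> ennreal (2 * real p * exp (t\<^sup>2 * (Xnorm n p X)\<^sup>2 / 2 - t * b))"
proof -
  have mgf: "(\<integral>\<^sup>+\<epsilon>. ennreal (exp (- (t * b)) * exp (dotp n \<epsilon> (\<lambda>m. r * X m j))) \<partial>noise n)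
     \<le> ennreal (exp (t\<^sup>2 * (Xnorm n p X)\<^sup>2 / 2 - t * b))" if "j < p" "r\<^sup>2 = t\<^sup>2" for j r
  proof -
    have "(l2norm n (\<lambda>m. r * X m j))\<^sup>2 = t\<^sup>2 * (l2norm n (\<lambda>m. X m j))\<^sup>2"
      unfolding l2norm_square that(2)[symmetric]
      by (simp add: dotp_def sum_distrib_left power2_eq_square algebra_simps)
    also have "\<dots> \<le> t\<^sup>2 * (Xnorm n p X)\<^sup>2"
      using column_norm_le[OF that(1)] l2norm_nonneg by (intro mult_left_mono power_mono) auto
    finally have le: "(l2norm n (\<lambda>m. r * X m j))\<^sup>2 \<le> t\<^sup>2 * (Xnorm n p X)\<^sup>2" .
    have "(\<integral>\<^sup>+\<epsilon>. ennreal (exp (- (t * b)) * exp (dotp n \<epsilon> (\<lambda>m. r * X m j))) \<partial>noise n)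
        = ennreal (exp (- (t * b))) * ennreal (exp ((l2norm n (\<lambda>m. r * X m j))\<^sup>2 / 2))"
      by (simp add: ennreal_mult nn_integral_cmult noise_mgf)
    also have "\<dots> \<le> ennreal (exp (t\<^sup>2 * (Xnorm n p X)\<^sup>2 / 2 - t * b))"
      using le by (simp flip: ennreal_mult exp_add)
    finally show ?thesis .
  qed
  have "(\<integral>\<^sup>+\<epsilon>. ennreal (tail_weight n p X t b \<epsilon>) \<partial>noise n)
     = (\<Sum>j<p. (\<integral>\<^sup>+\<epsilon>. ennreal (exp (- (t * b)) * exp (dotp n \<epsilon> (\<lambda>m. t * X m j))) \<partial>noise n)
         + (\<integral>\<^sup>+\<epsilon>. ennreal (exp (- (t * b)) * exp (dotp n \<epsilon> (\<lambda>m. - t * X m j))) \<partial>noise n))"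
    unfolding tail_weight_def
    by (simp add: sum_ennreal[symmetric] nn_integral_sum nn_integral_add ennreal_plus del: sum_ennreal)
  also have "\<dots> \<le> (\<Sum>j<p. ennreal (exp (t\<^sup>2 * (Xnorm n p X)\<^sup>2 / 2 - t * b))
         + ennreal (exp (t\<^sup>2 * (Xnorm n p X)\<^sup>2 / 2 - t * b)))"
    by (intro sum_mono add_mono mgf) auto
  also have "\<dots> = ennreal (2 * real p * exp (t\<^sup>2 * (Xnorm n p X)\<^sup>2 / 2 - t * b))"
    by (simp flip: ennreal_plus ennreal_of_nat_eq_real_of_nat ennreal_mult) (simp add: ennreal_of_nat_eq_real_of_nat mult.commute flip: ennreal_mult)
  finally show ?thesis .
qed

section \<open>Expected evidence ratio of a single model\<close>

locale sparse_setup = column_projection +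
  fixes prs :: "nat \<Rightarrow> real" and c0 :: real
  assumes p2: "2 \<le> p" and Xpos: "0 < Xnorm n p X"
    and lam_le: "lam \<le> 2 * lambar n p X"
    and prs: "\<forall>t\<le>p. 0 \<le> prs t" and prs_S0: "0 < prs (card S0)"
    and c0: "0 < c0" "ereal c0 \<le> compat n p X S0"
begin

text \<open>On the event that all columns have inner product at most \<open>lambar\<close> with the noise, a fraction
  \<open>kap\<close> of the linear term can be traded for an \<open>l1norm\<close>-penalty, which leaves the negative
  quadratic term \<open>- kap / 2 * (l2norm n (fit y))\<^sup>2\<close> after integrating over the noise.\<close>

definition kap :: real where "kap = lam / (4 * lambar n p X)"

text \<open>The constant \<open>e\<^sup>2 / (2 * kap)\<close> produced by completing the square in
  \<open>completed_square\<close>. Up to a constant depending on \<open>c0\<close> it is the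
  quantity assumed to vanish in the limit.\<close>

definition defect :: real where
  "defect = 25 / 4 * (real (card S0) * lam * sqrt (ln (real p)) / Xnorm n p X) / c0\<^sup>2"

text \<open>The fraction \<open>1 - kap\<close> of the noise term stays random. The rest has been
  replaced by \<open>lam / 4\<close> times the \<open>l1norm\<close> of \<open>resid y\<close>,
  which raises the coefficient of \<open>l1norm S0 (shift y)\<close> from 1 to 5/4.\<close>

definition bound_weight :: "(nat \<Rightarrow> real) \<Rightarrow> (nat \<Rightarrow> real) \<Rightarrow> real" where
  "bound_weight \<epsilon> y = exp (dotp n \<epsilon> (\<lambda>i. (1 - kap) * fit y i)) *
     exp (5 / 4 * lam * l1norm S0 (shift y) + lam / 4 * l1norm K y - (l2norm n (fit y))\<^sup>2 / 2)"

lemma lambar_pos: "0 < lambar n p X"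
  using p2 Xpos by (simp add: lambar_def)

lemma kap: "0 < kap" "kap \<le> 1 / 2"
  using lam lam_le lambar_pos by (simp_all add: kap_def field_simps)

lemma kap_lambar: "kap * lambar n p X = lam / 4"
  using lambar_pos by (simp add: kap_def)

lemma l1norm_resid: "l1norm S0 (resid y) = l1norm S0 (shift y)" "l1norm K (resid y) = l1norm K y"
  "l1norm {..<p} (resid y) = l1norm S0 (shift y) + l1norm K y"
proof -
  show 1: "l1norm S0 (resid y) = l1norm S0 (shift y)" "l1norm K (resid y) = l1norm K y"
    unfolding l1norm_def using S0_K(1) by (auto intro!: sum.cong simp: resid_def)
  have "l1norm {..<p} (resid y) = l1norm S0 (resid y) + l1norm K (resid y)"
    unfolding l1norm_def S0_K(2)[symmetric] using S0_K(1) fin_S0 fin_K by (simp add: sum.union_disjoint)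
  then show "l1norm {..<p} (resid y) = l1norm S0 (shift y) + l1norm K y"
    by (simp add: 1)
qed

text \<open>Hoelder's inequality for the fraction \<open>kap\<close> of the noise term;
  \<open>kap\<close> is chosen so that \<open>kap * lambar n p X = lam / 4\<close>.\<close>

lemma exponent_le_bound_weight:
  assumes "\<And>j. j < p \<Longrightarrow> \<bar>dotp n \<epsilon> (\<lambda>m. X m j)\<bar> \<le> lambar n p X"
  shows "exp (lam * l1norm S0 (shift y) + dotp n \<epsilon> (fit y) - (l2norm n (fit y))\<^sup>2 / 2) \<le> bound_weight \<epsilon> y"
proof -
  have "kap * dotp n \<epsilon> (fit y) \<le> kap * (lambar n p X * l1norm {..<p} (resid y))"
    using kap by (intro mult_left_mono dotp_matvec_le assms) auto
  also have "\<dots> = lam / 4 * (l1norm S0 (shift y) + l1norm K y)"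
    by (simp add: mult.assoc[symmetric] kap_lambar l1norm_resid)
  finally show ?thesis
    unfolding bound_weight_def exp_add[symmetric] dotp_scale_right
    by (simp add: algebra_simps)
qed

text \<open>Compatibility bounds \<open>l1norm S0 (shift y)\<close> by \<open>l1norm K y / 7\<close>
  plus a multiple of \<open>l2norm n (fit y)\<close>. As 5/4 * 1/7 = 5/28 is below 1/4, the first
  part raises \<open>lam / 4\<close> to at most \<open>lam / 2\<close>; the second is absorbed by
  the quadratic term.\<close>

lemma completed_square:
  "5 / 4 * lam * l1norm S0 (shift y) + lam / 4 * l1norm K y - kap / 2 * (l2norm n (fit y))\<^sup>2
    \<le> defect + lam / 2 * l1norm K y"
proof -
  define u where "u = l2norm n (fit y)"
  define e where "e = 5 / 4 * lam * sqrt (real (card S0)) / (c0 * Xnorm n p X)"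
  have "l1norm S0 (shift y) \<le> l1norm K y / 7 + u * sqrt (real (card S0)) / (c0 * Xnorm n p X)"
    using compat_bound[OF c0(2,1) Xpos fin_S0, of "resid y"]
    by (simp add: l1norm_resid K_eq[symmetric] u_def)
  then have "5 / 4 * lam * l1norm S0 (shift y)
      \<le> 5 / 4 * lam * (l1norm K y / 7 + u * sqrt (real (card S0)) / (c0 * Xnorm n p X))"
    using lam by (intro mult_left_mono) auto
  also have "\<dots> = 5 / 28 * (lam * l1norm K y) + e * u"
    by (simp add: e_def field_simps)
  finally have 1: "5 / 4 * lam * l1norm S0 (shift y) \<le> 5 / 28 * (lam * l1norm K y) + e * u" .
  \<comment> \<open>The weighted inequality of arithmetic and geometric means, with weight
    \<open>kap\<close> on the square of \<open>u\<close>.\<close>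
  have "0 \<le> (e - kap * u)\<^sup>2" by simp
  then have "2 * kap * (e * u) \<le> e\<^sup>2 + kap * (kap * u\<^sup>2)"
    by (simp add: power2_eq_square algebra_simps)
  then have "e * u \<le> e\<^sup>2 / (2 * kap) + kap / 2 * u\<^sup>2"
    using kap by (simp add: field_simps power2_eq_square)
  moreover have "e\<^sup>2 / (2 * kap) = defect"
    using lam Xpos c0 p2
    by (simp add: e_def kap_def lambar_def defect_def power_divide power_mult_distrib)
       (simp add: field_simps power2_eq_square)
  moreover have "0 \<le> lam * l1norm K y"
    using lam by (simp add: l1norm_def sum_nonneg)
  ultimately show ?thesis
    using 1 unfolding u_def[symmetric] by simp
qed

lemma nn_integral_bound_weight_noise:
  "(\<integral>\<^sup>+\<epsilon>. ennreal (bound_weight \<epsilon> y) \<partial>noise n) \<le> ennreal (exp defect) * ennreal (exp (lam / 2 * l1norm K y))"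
proof -
  let ?c = "5 / 4 * lam * l1norm S0 (shift y) + lam / 4 * l1norm K y - (l2norm n (fit y))\<^sup>2 / 2"
  have sq: "(l2norm n (\<lambda>i. (1 - kap) * fit y i))\<^sup>2 = (1 - kap)\<^sup>2 * (l2norm n (fit y))\<^sup>2"
    unfolding l2norm_square by (simp add: dotp_def sum_distrib_left power2_eq_square algebra_simps)
  \<comment> \<open>The moment generating function yields half of this left-hand side in the
    exponent. Since \<open>1 - kap\<close> lies in the unit interval, at least
    \<open>kap / 2\<close> of the negative quadratic term survives.\<close>
  have "(1 - kap)\<^sup>2 * (l2norm n (fit y))\<^sup>2 \<le> (1 - kap) * (l2norm n (fit y))\<^sup>2"
    using kap by (intro mult_right_mono) (auto simp: power2_eq_square mult_left_le)
  then have "(1 - kap)\<^sup>2 * (l2norm n (fit y))\<^sup>2 / 2 + ?c \<le> defect + lam / 2 * l1norm K y"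
    using completed_square[of y] by (simp add: algebra_simps)
  then show ?thesis
    unfolding bound_weight_def
    by (simp add: ennreal_mult nn_integral_multc noise_mgf sq del: exp_add)
       (simp flip: ennreal_mult exp_add)
qed

lemma sigma_finite_noise: "sigma_finite_measure (noise n)"
  by (intro prob_space_imp_sigma_finite prob_space_noise)

lemma sets_noise [measurable_cong]: "sets (noise n) = sets (PiM {..<n} (\<lambda>_. borel))"
  unfolding noise_def by (intro sets_PiM_cong) auto

lemma bound_weight_measurable [measurable]:
  "(\<lambda>(\<epsilon>, y). ennreal (bound_weight \<epsilon> y)) \<in> borel_measurable (noise n \<Otimes>\<^sub>M PiM K (coord_prior lam S))"
proof -
  have [measurable]: "(\<lambda>z. fst z i) \<in> borel_measurable (noise n \<Otimes>\<^sub>M PiM K (coord_prior lam S))" if "i < n" for i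
    using that by (intro measurable_compose[OF measurable_fst]) (simp add: noise_def)
  have [measurable]: "(\<lambda>z. snd z j) \<in> borel_measurable (noise n \<Otimes>\<^sub>M PiM K (coord_prior lam S))" if "j \<in> K" for j
    using that by (intro measurable_compose[OF measurable_snd]) simp
  show ?thesis
    unfolding bound_weight_def split_beta' l2norm_square dotp_def l1norm_def fit_eq shift_def
    by measurable
qed

text \<open>By Fubini the noise is integrated first, leaving only
  \<open>exp (lam / 2 * l1norm K y)\<close> up to a constant; its prior expectation is 2 per Laplace
  coordinate.\<close>

lemma nn_integral_bound_weight:
  "(\<integral>\<^sup>+\<epsilon>. \<integral>\<^sup>+y. ennreal (bound_weight \<epsilon> y) \<partial>PiM K (coord_prior lam S) \<partial>noise n)
    \<le> ennreal (exp defect) * 2 ^ card (K \<inter> S)"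
proof -
  interpret N: sigma_finite_measure "noise n" by (rule sigma_finite_noise)
  interpret P: sigma_finite_measure "PiM K (coord_prior lam S)"
    by (intro prob_space_imp_sigma_finite prob_space_PiM prob_space_coord_prior lam)
  interpret pair_sigma_finite "noise n" "PiM K (coord_prior lam S)" ..
  have "(\<integral>\<^sup>+\<epsilon>. \<integral>\<^sup>+y. ennreal (bound_weight \<epsilon> y) \<partial>PiM K (coord_prior lam S) \<partial>noise n)
      = (\<integral>\<^sup>+y. \<integral>\<^sup>+\<epsilon>. ennreal (bound_weight \<epsilon> y) \<partial>noise n \<partial>PiM K (coord_prior lam S))"
    by (rule Fubini'[symmetric]) measurable
  also have "\<dots> \<le> (\<integral>\<^sup>+y. ennreal (exp defect) * ennreal (exp (lam / 2 * l1norm K y)) \<partial>PiM K (coord_prior lam S))"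
    by (intro nn_integral_mono nn_integral_bound_weight_noise)
  also have "\<dots> = ennreal (exp defect) * 2 ^ card (K \<inter> S)"
    unfolding nn_integral_coord_prior_exp[OF lam fin_K, symmetric]
    by (intro nn_integral_cmult) (simp add: l1norm_def)
  finally show ?thesis .
qed

section \<open>Expected posterior mass for a fixed design\<close>

definition supersets :: "nat set set" where
  "supersets = {S. S0 \<subset> S \<and> S \<subseteq> {..<p}}"

lemma sel_weight_nonneg: "S \<subseteq> {..<p} \<Longrightarrow> 0 \<le> sel_weight p prs S"
  using prs card_mono[of "{..<p}" S] by (simp add: sel_weight_def)

text \<open>If some column correlates too strongly with the noise, the posterior is at most 1 and
  hence at most the tail weight; otherwise the evidence ratios are bounded by the
  \<open>bound_weight\<close> integrals. Adding both bounds gives one inequality valid for every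
  \<open>\<epsilon>\<close>, ready to be integrated.\<close>

lemma posterior_le:
  assumes "0 \<le> t"
  shows "ennreal (posterior n p X lam prs {\<beta>. S0 \<subset> supp p \<beta>} (obs \<epsilon>))
    \<le> ennreal (tail_weight n p X t (lambar n p X) \<epsilon>)
      + (\<Sum>S\<in>supersets. ennreal (sel_weight p prs S / sel_weight p prs S0) *
           (\<integral>\<^sup>+y. ennreal (bound_weight \<epsilon> y) \<partial>PiM K (coord_prior lam S)))"
    (is "ennreal ?post \<le> _ + ?rest")
proof (cases "\<forall>j<p. \<bar>dotp n \<epsilon> (\<lambda>m. X m j)\<bar> \<le> lambar n p X")
  case False
  then obtain j where "j < p" "lambar n p X < \<bar>dotp n \<epsilon> (\<lambda>m. X m j)\<bar>"
    by (auto simp: not_le)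
  then have "1 \<le> tail_weight n p X t (lambar n p X) \<epsilon>"
    using tail_weight_ge_1[OF assms] by blast
  moreover have "?post \<le> 1"
    by (rule posterior_superset_le(1)[OF lam prs S0_sub prs_S0])
  ultimately have "ennreal ?post \<le> ennreal (tail_weight n p X t (lambar n p X) \<epsilon>)"
    by (intro ennreal_leI) simp
  then show ?thesis by (rule order_trans) simp
next
  case True
  have ev0: "0 < evidence S \<epsilon>" for S
    unfolding evidence_def by (rule integral_likelihood_pos[OF lam])
  have ratio: "ennreal (evidence S \<epsilon> / evidence S0 \<epsilon>)
      \<le> (\<integral>\<^sup>+y. ennreal (bound_weight \<epsilon> y) \<partial>PiM K (coord_prior lam S))" (is "_ \<le> ?W")
    if "S \<in> supersets" for S
  proof -
    have "ennreal (evidence S \<epsilon>) \<le> ennreal (evidence S0 \<epsilon>) *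
    (\<integral>\<^sup>+y. ennreal (exp (lam * l1norm S0 (shift y) + dotp n \<epsilon> (fit y) - (l2norm n (fit y))\<^sup>2 / 2))
       \<partial>PiM K (coord_prior lam S))"
      using that by (intro evidence_le) (auto simp: supersets_def)
    also have "\<dots> \<le> ennreal (evidence S0 \<epsilon>) * ?W"
      using True by (intro mult_left_mono nn_integral_mono ennreal_leI exponent_le_bound_weight) auto
    \<comment> \<open>\<open>?W\<close> may be infinite, so the finite positive factor is cancelled
      by multiplying with its reciprocal.\<close>
    finally have "ennreal (1 / evidence S0 \<epsilon>) * ennreal (evidence S \<epsilon>)
        \<le> ennreal (1 / evidence S0 \<epsilon>) * (ennreal (evidence S0 \<epsilon>) * ?W)"
      by (rule mult_left_mono) simp
    also have "\<dots> = ennreal (1 / evidence S0 \<epsilon> * evidence S0 \<epsilon>) * ?W"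
      using ev0[of S0] by (simp only: mult.assoc[symmetric] ennreal_mult less_imp_le divide_nonneg_nonneg zero_le_one)
    also have "\<dots> = ?W"
      using ev0[of S0] by simp
    finally show ?thesis
      using ev0[of S0] ev0[of S] by (simp flip: ennreal_mult)
  qed
  have "?post \<le> (\<Sum>S\<in>supersets. sel_weight p prs S / sel_weight p prs S0 * (evidence S \<epsilon> / evidence S0 \<epsilon>))"
    unfolding supersets_def evidence_def
    by (rule posterior_superset_le(2)[OF lam prs S0_sub prs_S0])
  then have "ennreal ?post
      \<le> ennreal (\<Sum>S\<in>supersets. sel_weight p prs S / sel_weight p prs S0 * (evidence S \<epsilon> / evidence S0 \<epsilon>))"
    by (rule ennreal_leI)
  also have "\<dots> = (\<Sum>S\<in>supersets. ennreal (sel_weight p prs S / sel_weight p prs S0) * ennreal (evidence S \<epsilon> / evidence S0 \<epsilon>))"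
  proof -
    have "0 \<le> sel_weight p prs S / sel_weight p prs S0" if "S \<in> supersets" for S
      using that sel_weight_nonneg S0_sub by (simp add: supersets_def)
    then show ?thesis
      by (subst sum_ennreal[symmetric])
         (intro mult_nonneg_nonneg divide_nonneg_nonneg[OF less_imp_le[OF ev0] less_imp_le[OF ev0]]
            sum.cong refl ennreal_mult; assumption)+
  qed
  also have "\<dots> \<le> ?rest"
    by (intro sum_mono mult_left_mono ratio) auto
  finally show ?thesis
    by (rule order_trans) simp
qed

lemma post_exp_le:
  "post_exp n p X lam prs \<beta>0 {\<beta>. S0 \<subset> supp p \<beta>}
    \<le> 2 / real p + exp defect * (\<Sum>S\<in>supersets. sel_weight p prs S / sel_weight p prs S0 * 2 ^ card (S - S0))"
    (is "_ \<le> ?bd")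
  and post_exp_nonneg: "0 \<le> post_exp n p X lam prs \<beta>0 {\<beta>. S0 \<subset> supp p \<beta>}"
proof -
  let ?post = "\<lambda>\<epsilon>. posterior n p X lam prs {\<beta>. S0 \<subset> supp p \<beta>} (obs \<epsilon>)"
  \<comment> \<open>The minimizer of the Chernoff exponent; its minimum \<open>- 2 * ln p\<close>
    beats the \<open>2 * p\<close> terms and leaves \<open>2 / p\<close>.\<close>
  define t where "t = lambar n p X / (Xnorm n p X)\<^sup>2"
  have t: "0 \<le> t"
    using lambar_pos by (simp add: t_def)
  have post0: "0 \<le> ?post \<epsilon>" for \<epsilon>
    by (rule posterior_superset_le(3)[OF lam prs S0_sub prs_S0])
  show "0 \<le> post_exp n p X lam prs \<beta>0 {\<beta>. S0 \<subset> supp p \<beta>}"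
    unfolding post_exp_def by (intro integral_nonneg_AE) (simp add: post0)
  have wr: "0 \<le> sel_weight p prs S / sel_weight p prs S0" if "S \<in> supersets" for S
    using that sel_weight_nonneg S0_sub by (simp add: supersets_def)
  have bd0: "0 \<le> ?bd"
    using wr by (intro add_nonneg_nonneg mult_nonneg_nonneg sum_nonneg) auto
  have "t\<^sup>2 * (Xnorm n p X)\<^sup>2 / 2 - t * lambar n p X = - 2 * ln (real p)"
    using Xpos p2 by (simp add: t_def lambar_def power2_eq_square field_simps)
  then have "2 * real p * exp (t\<^sup>2 * (Xnorm n p X)\<^sup>2 / 2 - t * lambar n p X) = 2 * real p * exp (- ln (real p)) * exp (- ln (real p))"
    by (simp flip: exp_add)
  then have tail: "2 * real p * exp (t\<^sup>2 * (Xnorm n p X)\<^sup>2 / 2 - t * lambar n p X) = 2 / real p"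
    using p2 by (simp add: exp_minus field_simps)
  have tw_meas: "(\<lambda>\<epsilon>. ennreal (tail_weight n p X t (lambar n p X) \<epsilon>)) \<in> borel_measurable (noise n)"
    unfolding tail_weight_def by measurable
  have W_meas: "(\<lambda>\<epsilon>. \<integral>\<^sup>+y. ennreal (bound_weight \<epsilon> y) \<partial>PiM K (coord_prior lam S)) \<in> borel_measurable (noise n)" for S
  proof -
    interpret P: sigma_finite_measure "PiM K (coord_prior lam S)"
      by (intro prob_space_imp_sigma_finite prob_space_PiM prob_space_coord_prior lam)
    show ?thesis by measurable
  qed
  have "(\<integral>\<^sup>+\<epsilon>. ennreal (?post \<epsilon>) \<partial>noise n)
    \<le> (\<integral>\<^sup>+\<epsilon>. ennreal (tail_weight n p X t (lambar n p X) \<epsilon>)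
      + (\<Sum>S\<in>supersets. ennreal (sel_weight p prs S / sel_weight p prs S0) *
           (\<integral>\<^sup>+y. ennreal (bound_weight \<epsilon> y) \<partial>PiM K (coord_prior lam S))) \<partial>noise n)"
    by (intro nn_integral_mono posterior_le t)
  also have "\<dots> = (\<integral>\<^sup>+\<epsilon>. ennreal (tail_weight n p X t (lambar n p X) \<epsilon>) \<partial>noise n)
      + (\<Sum>S\<in>supersets. ennreal (sel_weight p prs S / sel_weight p prs S0) *
           (\<integral>\<^sup>+\<epsilon>. \<integral>\<^sup>+y. ennreal (bound_weight \<epsilon> y) \<partial>PiM K (coord_prior lam S) \<partial>noise n))"
    using tw_meas W_meas by (simp add: nn_integral_add nn_integral_sum nn_integral_cmult)
  also have "\<dots> \<le> ennreal (2 / real p)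
      + (\<Sum>S\<in>supersets. ennreal (sel_weight p prs S / sel_weight p prs S0) * (ennreal (exp defect) * 2 ^ card (K \<inter> S)))"
    using p2 by (intro add_mono sum_mono mult_left_mono nn_integral_bound_weight
        order_trans[OF nn_integral_tail_weight[where t=t and b="lambar n p X"]]) (auto simp: tail)
  also have "\<dots> = ennreal ?bd"
  proof -
    have "ennreal (sel_weight p prs S / sel_weight p prs S0) * (ennreal (exp defect) * 2 ^ card (K \<inter> S))
       = ennreal (exp defect * (sel_weight p prs S / sel_weight p prs S0 * 2 ^ card (S - S0)))"
      if "S \<in> supersets" for S
    proof -
      have "K \<inter> S = S - S0"
        using that by (auto simp: supersets_def K_eq)
      moreover have "(2::ennreal) ^ m = ennreal (2 ^ m)" for m
        by (simp flip: ennreal_power)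
      ultimately show ?thesis
        using wr[OF that] by (simp add: mult.left_commute flip: ennreal_mult)
    qed
    then have "(\<Sum>S\<in>supersets. ennreal (sel_weight p prs S / sel_weight p prs S0) * (ennreal (exp defect) * 2 ^ card (K \<inter> S)))
        = (\<Sum>S\<in>supersets. ennreal (exp defect * (sel_weight p prs S / sel_weight p prs S0 * 2 ^ card (S - S0))))"
      by (rule sum.cong[OF refl])
    also have "\<dots> = ennreal (\<Sum>S\<in>supersets. exp defect * (sel_weight p prs S / sel_weight p prs S0 * 2 ^ card (S - S0)))"
      using wr by (intro sum_ennreal mult_nonneg_nonneg) auto
    finally have eq: "(\<Sum>S\<in>supersets. ennreal (sel_weight p prs S / sel_weight p prs S0) * (ennreal (exp defect) * 2 ^ card (K \<inter> S)))
        = ennreal (\<Sum>S\<in>supersets. exp defect * (sel_weight p prs S / sel_weight p prs S0 * 2 ^ card (S - S0)))" .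
    have "0 \<le> (\<Sum>S\<in>supersets. exp defect * (sel_weight p prs S / sel_weight p prs S0 * 2 ^ card (S - S0)))"
      using wr by (intro sum_nonneg mult_nonneg_nonneg) auto
    then show ?thesis
      unfolding eq sum_distrib_left by (intro ennreal_plus[symmetric]) auto
  qed
  finally have le: "(\<integral>\<^sup>+\<epsilon>. ennreal (?post \<epsilon>) \<partial>noise n) \<le> ennreal ?bd" .
  show "post_exp n p X lam prs \<beta>0 {\<beta>. S0 \<subset> supp p \<beta>} \<le> ?bd"
  proof (cases "integrable (noise n) ?post")
    case True
    then have "ennreal (integral\<^sup>L (noise n) ?post) = (\<integral>\<^sup>+\<epsilon>. ennreal (?post \<epsilon>) \<partial>noise n)"
      by (intro nn_integral_eq_integral[symmetric]) (auto simp: post0)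
    with le have "ennreal (integral\<^sup>L (noise n) ?post) \<le> ennreal ?bd"
      by (simp only:)
    then show ?thesis
      unfolding post_exp_def using ennreal_le_iff[OF bd0] by blast
  next
    \<comment> \<open>The Bochner integral defaults to 0 here, and the bound is nonnegative.\<close>
    case False
    then show ?thesis
      using bd0 by (simp add: post_exp_def not_integrable_integral_eq)
  qed
qed

end

section \<open>Prior weights of strict supersets\<close>

text \<open>Removing \<open>S0\<close> is a bijection onto the nonempty subsets of
  \<open>U - S0\<close>, which are then grouped by size.\<close>

lemma sum_supersets_card:
  fixes f :: "nat \<Rightarrow> real"
  assumes "finite U" "S0 \<subseteq> U"
  shows "(\<Sum>S\<in>{S. S0 \<subset> S \<and> S \<subseteq> U}. f (card (S - S0)))
    = (\<Sum>k=1..card (U - S0). real (card (U - S0) choose k) * f k)"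
proof -
  let ?K = "U - S0"
  have finK: "finite ?K" using assms by simp
  have "(\<Sum>S\<in>{S. S0 \<subset> S \<and> S \<subseteq> U}. f (card (S - S0))) = (\<Sum>T\<in>Pow ?K - {{}}. f (card T))"
    by (rule sum.reindex_bij_witness[where i="\<lambda>T. S0 \<union> T" and j="\<lambda>S. S - S0"]) (use assms in auto)
  also have "\<dots> = (\<Sum>k=1..card ?K. \<Sum>T\<in>{T \<in> Pow ?K - {{}}. card T = k}. f (card T))"
  proof (rule sum.group[symmetric])
    show "card ` (Pow ?K - {{}}) \<subseteq> {1..card ?K}"
    proof
      fix k assume "k \<in> card ` (Pow ?K - {{}})"
      then obtain T where T: "T \<subseteq> ?K" "T \<noteq> {}" "k = card T" by auto
      then have "finite T" using finK finite_subset by blast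
      then have "0 < card T" using T by (simp add: card_gt_0_iff)
      then show "k \<in> {1..card ?K}" using T card_mono[OF finK] by auto
    qed
  qed (use finK in auto)
  also have "\<dots> = (\<Sum>k=1..card ?K. real (card ?K choose k) * f k)"
  proof (rule sum.cong[OF refl])
    fix k assume "k \<in> {1..card ?K}"
    then have "{T \<in> Pow ?K - {{}}. card T = k} = {T. T \<subseteq> ?K \<and> card T = k}" by auto
    then show "(\<Sum>T\<in>{T \<in> Pow ?K - {{}}. card T = k}. f (card T)) = real (card ?K choose k) * f k"
      using n_subsets[OF finK, of k] by simp
  qed
  finally show ?thesis .
qed

text \<open>Induction by the absorption identity, using
  \<open>Suc (m + k) \<le> Suc k * Suc m\<close>.\<close>

lemma binomial_le_Suc_power: "(m + k) choose k \<le> Suc m ^ k"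
proof (induction k)
  case (Suc k)
  have "Suc k * ((m + Suc k) choose Suc k) = Suc (m + k) * ((m + k) choose k)"
    using Suc_times_binomial[of k "m + k"] by simp
  also have "\<dots> \<le> (Suc k * Suc m) * Suc m ^ k"
    using Suc by (intro mult_mono) auto
  finally have "Suc k * ((m + Suc k) choose Suc k) \<le> Suc k * Suc m ^ Suc k"
    by (simp add: algebra_simps)
  then show ?case by (simp only: mult_le_cancel1)
qed simp

lemma sum_power_le_double:
  fixes x :: real
  assumes "0 \<le> x" "x \<le> 1 / 2"
  shows "(\<Sum>k=1..m. x ^ k) \<le> 2 * x"
proof -
  have "(\<Sum>k=1..m. x ^ k) * (1 - x) = x - x ^ Suc m"
  proof (induction m)
    case (Suc m)
    have "(\<Sum>k=1..Suc m. x ^ k) * (1 - x) = (\<Sum>k=1..m. x ^ k) * (1 - x) + x ^ Suc m * (1 - x)"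
      by (simp add: distrib_right)
    also have "\<dots> = x - x ^ Suc m + x ^ Suc m * (1 - x)"
      by (simp only: Suc.IH)
    also have "\<dots> = x - x ^ Suc (Suc m)"
      by (simp add: algebra_simps)
    finally show ?case .
  qed simp
  then have "(\<Sum>k=1..m. x ^ k) * (1 - x) \<le> x"
    using assms by simp
  moreover have "(\<Sum>k=1..m. x ^ k) * (1 / 2) \<le> (\<Sum>k=1..m. x ^ k) * (1 - x)"
    using assms by (intro mult_left_mono sum_nonneg) auto
  ultimately show ?thesis by simp
qed

text \<open>The number of supersets with \<open>k\<close> extra elements almost cancels against the
  ratio of the uniform weights: only \<open>(s + k) choose s\<close> remains, at most
  \<open>(s + 1) ^ k\<close> and free of \<open>p\<close>. With the decay \<open>q ^ k\<close> this
  is a geometric series.\<close>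

lemma sum_sel_weight_le:
  assumes S0: "S0 \<subseteq> {..<p}" and pos: "0 < prs (card S0)" and q: "0 \<le> q"
    and decay: "\<forall>t\<in>{1..p}. prs t \<le> q * prs (t - 1)"
    and small: "2 * real (Suc (card S0)) * q \<le> 1 / 2"
  shows "(\<Sum>S\<in>{S. S0 \<subset> S \<and> S \<subseteq> {..<p}}. sel_weight p prs S / sel_weight p prs S0 * 2 ^ card (S - S0))
    \<le> 2 * (2 * real (Suc (card S0)) * q)"
proof -
  let ?s = "card S0"
  let ?m = "card ({..<p} - S0)"
  have fin0: "finite S0" using S0 finite_subset by blast
  have sp: "?s \<le> p" using card_mono[of "{..<p}" S0] S0 by simp
  have m: "?m = p - ?s" using card_Diff_subset[OF fin0 S0] by simp
  have geo: "prs (?s + k) \<le> q ^ k * prs ?s" if "?s + k \<le> p" for k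
    using that
  proof (induction k)
    case (Suc k)
    have "prs (?s + Suc k) \<le> q * prs (?s + k)"
      using decay[rule_format, of "?s + Suc k"] Suc.prems by simp
    also have "\<dots> \<le> q * (q ^ k * prs ?s)"
      using Suc q by (intro mult_left_mono) auto
    finally show ?case by (simp add: mult.assoc)
  qed simp
  define f where "f = (\<lambda>k. prs (?s + k) / real (p choose (?s + k)) / sel_weight p prs S0 * 2 ^ k)"
  have "sel_weight p prs S / sel_weight p prs S0 * 2 ^ card (S - S0) = f (card (S - S0))"
    if S: "S0 \<subset> S" "S \<subseteq> {..<p}" for S
  proof -
    have "card S = ?s + card (S - S0)"
      using S card_Diff_subset[OF fin0, of S] card_mono[of S S0] finite_subset[OF S(2)] by auto
    then show ?thesis by (simp add: f_def sel_weight_def)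
  qed
  then have "(\<Sum>S\<in>{S. S0 \<subset> S \<and> S \<subseteq> {..<p}}. sel_weight p prs S / sel_weight p prs S0 * 2 ^ card (S - S0))
      = (\<Sum>S\<in>{S. S0 \<subset> S \<and> S \<subseteq> {..<p}}. f (card (S - S0)))"
    by (intro sum.cong) auto
  also have "\<dots> = (\<Sum>k=1..?m. real (?m choose k) * f k)"
    by (rule sum_supersets_card[OF _ S0]) simp
  also have "\<dots> \<le> (\<Sum>k=1..?m. (2 * real (Suc ?s) * q) ^ k)"
  proof (rule sum_mono)
    fix k assume "k \<in> {1..?m}"
    then have k: "?s + k \<le> p" using m sp by auto
    have "(p choose (?s + k)) * ((?s + k) choose ?s) = (p choose ?s) * (?m choose k)"
      using choose_mult[of ?s "?s + k" p] k by (simp add: m)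
    then have id: "real (p choose (?s + k)) * real ((?s + k) choose ?s) = real (p choose ?s) * real (?m choose k)"
      by (simp flip: of_nat_mult)
    have nz: "0 < real (p choose (?s + k))" "0 < real (p choose ?s)"
      using k sp by simp_all
    have "real (?m choose k) * f k
        = (real (p choose ?s) * real (?m choose k)) / real (p choose (?s + k)) * (prs (?s + k) / prs ?s) * 2 ^ k"
      using nz pos by (simp add: f_def sel_weight_def field_simps)
    also have "\<dots> = real ((?s + k) choose ?s) * (prs (?s + k) / prs ?s) * 2 ^ k"
      unfolding id[symmetric] using nz by simp
    also have "\<dots> \<le> real (Suc ?s) ^ k * q ^ k * 2 ^ k"
    proof -
      have "(?s + k) choose ?s \<le> Suc ?s ^ k"
        using binomial_le_Suc_power[of ?s k] binomial_symmetric[of k "?s + k"] by simp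
      then have "real ((?s + k) choose ?s) \<le> real (Suc ?s) ^ k"
        by (metis of_nat_le_iff of_nat_power)
      moreover have "prs (?s + k) / prs ?s \<le> q ^ k"
        using geo[OF k] pos by (simp add: field_simps)
      moreover have "0 \<le> q ^ k" using q by simp
      ultimately have "real ((?s + k) choose ?s) * (prs (?s + k) / prs ?s) \<le> real (Suc ?s) ^ k * q ^ k"
        by (intro order_trans[OF mult_left_mono mult_right_mono]) (simp_all only: of_nat_0_le_iff)
      then show ?thesis
        by (intro mult_right_mono) auto
    qed
    also have "\<dots> = (2 * real (Suc ?s) * q) ^ k"
      by (simp only: power_mult_distrib mult.assoc mult.commute[of _ "2 ^ k"])
    finally show "real (?m choose k) * f k \<le> (2 * real (Suc ?s) * q) ^ k" .
  qed
  also have "\<dots> \<le> 2 * (2 * real (Suc ?s) * q)"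
    using q small by (intro sum_power_le_double) auto
  finally show ?thesis .
qed

text \<open>If \<open>prs 0\<close> were 0, the upper bound would make every weight vanish, against
  total mass 1. The lower bound then carries positivity upwards.\<close>

lemma prior_positive:
  fixes prs :: "nat \<Rightarrow> real"
  assumes nonneg: "\<forall>t\<le>p. 0 \<le> prs t" and total: "(\<Sum>t\<le>p. prs t) = 1" and r: "0 < r"
    and decay: "\<forall>t\<in>{1..p}. r * prs (t - 1) \<le> prs t \<and> prs t \<le> q * prs (t - 1)"
  shows "t \<le> p \<Longrightarrow> 0 < prs t"
proof (induction t)
  case 0
  show ?case
  proof (rule ccontr)
    assume "\<not> 0 < prs 0"
    then have z: "prs 0 = 0" using nonneg by (simp add: order_antisym not_less)
    have "prs t = 0" if "t \<le> p" for t
      using that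
    proof (induction t)
      case (Suc t)
      then have "prs (Suc t) \<le> 0" using decay[rule_format, of "Suc t"] by simp
      then show ?case using nonneg Suc.prems by (simp add: order_antisym)
    qed (rule z)
    then show False using total by simp
  qed
next
  case (Suc t)
  then have "0 < r * prs t" using r by simp
  also have "\<dots> \<le> prs (Suc t)" using decay[rule_format, of "Suc t"] Suc.prems by simp
  finally show ?case .
qed

section \<open>Uniform bound and passage to the limit\<close>

text \<open>Replacing \<open>card S0\<close> by its bound \<open>s\<close> makes the estimate
  independent of \<open>\<beta>0\<close>, hence fit for a supremum.\<close>

lemma post_exp_superset_bounds:
  fixes n p :: nat and X :: "nat \<Rightarrow> nat \<Rightarrow> real" and lam c0 q r :: real
    and prs :: "nat \<Rightarrow> real" and \<beta>0 :: "nat \<Rightarrow> real" and S0 :: "nat set" and s :: nat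
  defines "S0 \<equiv> supp p \<beta>0"
  assumes lam: "0 < lam" "lam \<le> 2 * lambar n p X" and p2: "2 \<le> p"
    and prs: "\<forall>t\<le>p. 0 \<le> prs t" "(\<Sum>t\<le>p. prs t) = 1"
    and decay: "0 < r" "0 \<le> q" "\<forall>t\<in>{1..p}. r * prs (t - 1) \<le> prs t \<and> prs t \<le> q * prs (t - 1)"
    and c0: "0 < c0" "ereal c0 \<le> compat n p X S0"
    and s: "card S0 \<le> s" and small: "2 * (real s + 1) * q \<le> 1 / 2"
  shows "post_exp n p X lam prs \<beta>0 {\<beta>. S0 \<subset> supp p \<beta>}
      \<le> 2 / real p + exp (25 / 4 * (real s * lam * sqrt (ln (real p)) / Xnorm n p X) / c0\<^sup>2)
           * (2 * (2 * (real s + 1) * q))"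
    and "0 \<le> post_exp n p X lam prs \<beta>0 {\<beta>. S0 \<subset> supp p \<beta>}"
proof -
  have S0: "S0 \<subseteq> {..<p}" by (auto simp: S0_def supp_def)
  have sp: "card S0 \<le> p" using card_mono[of "{..<p}" S0] S0 by simp
  have pos: "0 < prs (card S0)"
    using prior_positive[OF prs decay(1,3) sp] .
  \<comment> \<open>The upper bound on the positive \<open>lam\<close> excludes a zero
    design.\<close>
  have "0 < lambar n p X" using lam by simp
  then have Xpos: "0 < Xnorm n p X"
    using p2 by (simp add: lambar_def zero_less_mult_iff)
  have "\<forall>l. \<exists>g. \<forall>i\<in>S0. dotp n (\<lambda>m. X m i) (\<lambda>m. X m l - (\<Sum>j\<in>S0. g j * X m j)) = 0"
    using projection_coeffs[OF finite_subset[OF S0 finite_lessThan], where x="\<lambda>j m. X m j"] by auto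
  then obtain G where G: "\<And>l i. i \<in> S0 \<Longrightarrow> dotp n (\<lambda>m. X m i) (\<lambda>m. X m l - (\<Sum>j\<in>S0. G l j * X m j)) = 0"
    by metis
  interpret L: sparse_setup n p X lam \<beta>0 S0 "{..<p} - S0" G prs c0
    by unfold_locales (use lam p2 Xpos prs pos c0 G in \<open>auto simp: S0_def\<close>)
  show "0 \<le> post_exp n p X lam prs \<beta>0 {\<beta>. S0 \<subset> supp p \<beta>}"
    by (rule L.post_exp_nonneg)
  have le: "2 * real (Suc (card S0)) * q \<le> 2 * (real s + 1) * q"
    using s decay(2) by (intro mult_right_mono) auto
  have sum_le: "(\<Sum>S\<in>L.supersets. sel_weight p prs S / sel_weight p prs S0 * 2 ^ card (S - S0))
      \<le> 2 * (2 * real (Suc (card S0)) * q)"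
    unfolding L.supersets_def
    using decay le small by (intro sum_sel_weight_le S0 pos) auto
  have "L.defect \<le> 25 / 4 * (real s * lam * sqrt (ln (real p)) / Xnorm n p X) / c0\<^sup>2"
    unfolding L.defect_def using s lam Xpos p2
    by (intro divide_right_mono mult_left_mono mult_right_mono) auto
  then have "exp L.defect * (\<Sum>S\<in>L.supersets. sel_weight p prs S / sel_weight p prs S0 * 2 ^ card (S - S0))
      \<le> exp (25 / 4 * (real s * lam * sqrt (ln (real p)) / Xnorm n p X) / c0\<^sup>2) * (2 * (2 * (real s + 1) * q))"
  proof (intro mult_mono)
    show "(\<Sum>S\<in>L.supersets. sel_weight p prs S / sel_weight p prs S0 * 2 ^ card (S - S0))
      \<le> 2 * (2 * (real s + 1) * q)"
      using sum_le le by linarith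
    show "0 \<le> (\<Sum>S\<in>L.supersets. sel_weight p prs S / sel_weight p prs S0 * 2 ^ card (S - S0))"
      unfolding L.supersets_def
      by (intro sum_nonneg mult_nonneg_nonneg divide_nonneg_nonneg L.sel_weight_nonneg S0) auto
  qed simp_all
  then show "post_exp n p X lam prs \<beta>0 {\<beta>. S0 \<subset> supp p \<beta>}
      \<le> 2 / real p + exp (25 / 4 * (real s * lam * sqrt (ln (real p)) / Xnorm n p X) / c0\<^sup>2)
           * (2 * (2 * (real s + 1) * q))"
    using L.post_exp_le by simp
qed

theorem theorem4:
  fixes n p :: "nat \<Rightarrow> nat"
    and X :: "nat \<Rightarrow> nat \<Rightarrow> nat \<Rightarrow> real"
    and lam :: "nat \<Rightarrow> real"
    and prs :: "nat \<Rightarrow> nat \<Rightarrow> real"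
    and A1 A2 A3 A4 a c0 :: real
    and s :: "nat \<Rightarrow> nat"
  assumes n_lim: "filterlim n at_top sequentially"
    and p_lim: "filterlim p at_top sequentially"
    and prior_nonneg: "\<forall>k. \<forall>t\<le>p k. prs k t \<ge> 0"
    and prior_sum: "\<forall>k. (\<Sum>t\<le>p k. prs k t) = 1"
    and lam_pos: "\<forall>k. lam k > 0"
    and lam_bounds: "\<forall>k. Xnorm (n k) (p k) (X k) / real (p k) \<le> lam k
                        \<and> lam k \<le> 2 * lambar (n k) (p k) (X k)"
    and A1: "A1 > 0" and A2: "A2 > 0" and A3: "A3 > 0" and A4: "A4 > 1"
    and prior_decay: "\<forall>k. \<forall>t\<in>{1..p k}.
           A1 * real (p k) powr (- A3) * prs k (t - 1) \<le> prs k t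
         \<and> prs k t \<le> A2 * real (p k) powr (- A4) * prs k (t - 1)"
    and c0: "c0 > 0"
    and a: "a < A4 - 1"
    and s_le: "\<forall>k. real (s k) \<le> real (p k) powr a"
    and s_lim: "(\<lambda>k. real (s k) * lam k * sqrt (ln (real (p k))) / Xnorm (n k) (p k) (X k))
                  \<longlonglongrightarrow> 0"
  shows "(\<lambda>k. SUP \<beta>0 \<in> {\<beta>0. compat (n k) (p k) (X k) (supp (p k) \<beta>0) \<ge> ereal c0
                            \<and> card (supp (p k) \<beta>0) \<le> s k
                            \<and> tpsi (n k) (p k) (X k) (lam k) A4 (supp (p k) \<beta>0) \<ge> ereal c0}.
              post_exp (n k) (p k) (X k) (lam k) (prs k) \<beta>0
                {\<beta>. supp (p k) \<beta>0 \<subset> supp (p k) \<beta>})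
         \<longlonglongrightarrow> 0"
proof -
  define u where "u = (\<lambda>k. real (s k) * lam k * sqrt (ln (real (p k))) / Xnorm (n k) (p k) (X k))"
  define x where "x = (\<lambda>k. 2 * (real (s k) + 1) * (A2 * real (p k) powr (- A4)))"
  define bd where "bd = (\<lambda>k. 2 / real (p k) + exp (25 / 4 * u k / c0\<^sup>2) * (2 * x k))"
  have p_real: "filterlim (\<lambda>k. real (p k)) at_top sequentially"
    by (rule filterlim_compose[OF filterlim_real_sequentially p_lim])
  have x_lim: "x \<longlonglongrightarrow> 0"
  proof (rule tendsto_sandwich[OF _ _ tendsto_const])
    show "\<forall>\<^sub>F k in sequentially. 0 \<le> x k"
      using A2 by (simp add: x_def)
    show "\<forall>\<^sub>F k in sequentially. x k \<le> 2 * (real (p k) powr a + 1) * (A2 * real (p k) powr (- A4))"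
      unfolding x_def using A2 s_le by (intro always_eventually allI mult_right_mono mult_left_mono add_mono) auto
    have "((\<lambda>z. 2 * (z powr a + 1) * (A2 * z powr (- A4))) \<longlongrightarrow> 0) at_top"
    proof -
      \<comment> \<open>Both exponents are negative, the first because
        \<open>a < A4 - 1\<close>.\<close>
      have "((\<lambda>z. 2 * A2 * z powr (a - A4) + 2 * A2 * z powr (- A4)) \<longlongrightarrow> 2 * A2 * 0 + 2 * A2 * 0) at_top"
        using a A4 by (intro tendsto_intros tendsto_neg_powr filterlim_ident) auto
      then show ?thesis
        by (simp add: algebra_simps powr_add[symmetric])
    qed
    then show "(\<lambda>k. 2 * (real (p k) powr a + 1) * (A2 * real (p k) powr (- A4))) \<longlonglongrightarrow> 0"
      by (rule filterlim_compose[OF _ p_real])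
  qed
  have bd_lim: "bd \<longlonglongrightarrow> 0"
  proof -
    have "(\<lambda>k. 2 / real (p k)) \<longlonglongrightarrow> 0"
      by (rule tendsto_divide_0[OF tendsto_const filterlim_at_top_imp_at_infinity[OF p_real]])
    moreover have "(\<lambda>k. exp (25 / 4 * u k / c0\<^sup>2) * (2 * x k)) \<longlonglongrightarrow> exp (25 / 4 * 0 / c0\<^sup>2) * (2 * 0)"
      using c0 s_lim x_lim by (intro tendsto_intros) (auto simp: u_def)
    ultimately show ?thesis
      unfolding bd_def using tendsto_add by fastforce
  qed
  have ev: "\<forall>\<^sub>F k in sequentially. 2 \<le> p k \<and> x k \<le> 1 / 2"
  proof -
    have "\<forall>\<^sub>F k in sequentially. x k < 1 / 2"
      using x_lim by (rule order_tendstoD) simp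
    moreover have "\<forall>\<^sub>F k in sequentially. 2 \<le> p k"
      using p_lim by (simp add: filterlim_at_top)
    ultimately show ?thesis by eventually_elim simp
  qed
  let ?A = "\<lambda>k. {\<beta>0. compat (n k) (p k) (X k) (supp (p k) \<beta>0) \<ge> ereal c0
      \<and> card (supp (p k) \<beta>0) \<le> s k \<and> tpsi (n k) (p k) (X k) (lam k) A4 (supp (p k) \<beta>0) \<ge> ereal c0}"
  let ?E = "\<lambda>k \<beta>0. post_exp (n k) (p k) (X k) (lam k) (prs k) \<beta>0 {\<beta>. supp (p k) \<beta>0 \<subset> supp (p k) \<beta>}"
  \<comment> \<open>For the zero vector both infima range over the empty set and are infinite, so
    the supremum is taken over a nonempty set.\<close>
  have zero_mem: "(\<lambda>_. 0) \<in> ?A k" for k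
  proof -
    have "card (supp (p k) \<beta>) = 0 \<longleftrightarrow> supp (p k) \<beta> = {}" for \<beta> :: "nat \<Rightarrow> real"
      by (simp add: supp_def card_eq_0_iff)
    then show ?thesis
      by (simp add: supp_def[of _ "\<lambda>_. 0"] compat_def tpsi_def tphi_def top_ereal_def cong: conj_cong)
  qed
  have bounds: "?E k \<beta>0 \<le> bd k" "0 \<le> ?E k \<beta>0" if "2 \<le> p k" "x k \<le> 1 / 2" "\<beta>0 \<in> ?A k" for k \<beta>0
  proof -
    have r: "0 < A1 * real (p k) powr (- A3)" and q: "0 \<le> A2 * real (p k) powr (- A4)"
      using A1 A2 that(1) by auto
    have lam: "lam k \<le> 2 * lambar (n k) (p k) (X k)" using lam_bounds by simp
    have \<beta>0: "ereal c0 \<le> compat (n k) (p k) (X k) (supp (p k) \<beta>0)" "card (supp (p k) \<beta>0) \<le> s k"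
      using that(3) by auto
    note * = post_exp_superset_bounds[OF lam_pos[THEN spec, of k] lam that(1) prior_nonneg[THEN spec, of k]
        prior_sum[THEN spec, of k] r q prior_decay[THEN spec, of k] c0 \<beta>0 that(2)[unfolded x_def]]
    show "?E k \<beta>0 \<le> bd k"
      unfolding bd_def u_def x_def by (rule *(1))
    show "0 \<le> ?E k \<beta>0"
      by (rule *(2))
  qed
  show ?thesis
  proof (rule tendsto_sandwich[OF _ _ tendsto_const bd_lim])
    show "\<forall>\<^sub>F k in sequentially. 0 \<le> (SUP \<beta>0 \<in> ?A k. ?E k \<beta>0)"
      using ev
    proof eventually_elim
      case (elim k)
      have "0 \<le> ?E k (\<lambda>_. 0)"
        using elim zero_mem by (intro bounds) auto
      \<comment> \<open>For a supremum in the reals the set of values must be bounded above;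
        \<open>bd k\<close> serves as the bound.\<close>
      also have "\<dots> \<le> (SUP \<beta>0 \<in> ?A k. ?E k \<beta>0)"
        using elim zero_mem bounds(1) by (intro cSUP_upper bdd_aboveI2[of _ _ "bd k"]) auto
      finally show ?case .
    qed
    show "\<forall>\<^sub>F k in sequentially. (SUP \<beta>0 \<in> ?A k. ?E k \<beta>0) \<le> bd k"
      using ev
    proof eventually_elim
      case (elim k)
      then show ?case
        using zero_mem bounds(1) by (intro cSUP_least) blast+
    qed
  qed
qed

end
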